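(* A compact space $X$ is Valdivia if and only if it has a dense subset $Y$ which is commutatively monotonically retractable in $X$.
   Context: All spaces are Tychonoff (completely regular and Hausdorff). For a set $S$, $\mathcal{P}(S)$ is its power set and $[S]^{\leq\omega}$ is the family of all countable subsets of $S$, ordered by inclusion. A retraction on $X$ is a continuous map $r:X\to X$ with $r\circ r=r$; writing $r:X\to Y$ for a retraction with $Y\subseteq X$ means $r(X)\subseteq Y$. For a set $T$, $\Sigma\mathbb{R}^T=\{f\in\mathbb{R}^T : |f^{-1}(\mathbb{R}\setminus\{0\})|\leq\omega\}$. A set $Y\subseteq X$ is a $\Sigma$-subset of $X$ if there is an embedding $\phi:X\to\mathbb{R}^T$, for some set $T$, such that $Y=\phi^{-1}(\Sigma\mathbb{R}^T)$. A compact space is Valdivia if it admits a dense $\Sigma$-subset. For sets $S,S'$, a map $\phi:[S]^{\leq\omega}\to[S']^{\leq\omega}$ is $\omega$-monotone if $A\subseteq B$ implies $\phi(A)\subseteq\phi(B)$, and $\phi(\bigcup_n A_n)=\bigcup_n\phi(A_n)$ for every increasing sequence $A_0\subseteq A_1\subseteq\cdots$ in $[S]^{\leq\omega}$. For $f:Z\to W$ and $\mathcal{N}\subseteq\mathcal{P}(Z)$, $\mathcal{N}$ is a network of $f$ if for every $z\in Z$ and each open $U\subseteq W$ with $f(z)\in U$ there is $N\in\mathcal{N}$ with $z\in N$ and $f(N)\subseteq U$. A subspace $Y$ of $X$ is monotonically retractable in $X$ if one can assign to each $A\in[Y]^{\leq\omega}$ a retraction $r_A:X\to Y$ and a family $\mathcal{O}(A)\in[\mathcal{P}(Y)]^{\leq\omega}$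 such that: (i) $A\subseteq r_A(X)$; (ii) $\mathcal{O}(A)$ is a network of $r_A\restriction_Y$; (iii) $\mathcal{O}$ is $\omega$-monotone. If in addition $r_A\circ r_B=r_B\circ r_A$ for all $A,B\in[Y]^{\leq\omega}$, then $Y$ is commutatively monotonically retractable in $X$. *)

theory Defs
  imports "HOL-Analysis.Analysis"
begin

definition countable_subsets :: "'a set \<Rightarrow> 'a set set"
  where "countable_subsets S = {A. A \<subseteq> S \<and> countable A}"

definition retraction_to :: "'a topology \<Rightarrow> 'a set \<Rightarrow> ('a \<Rightarrow> 'a) \<Rightarrow> bool"
  where "retraction_to X Y r \<longleftrightarrow>
    continuous_map X X r \<and> (\<forall>x\<in>topspace X. r (r x) = r x) \<and> r ` topspace X \<subseteq> Y"

definition Sigma_product :: "'i set \<Rightarrow> ('i \<Rightarrow> real) set"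
  where "Sigma_product T = {f \<in> topspace (powertop_real T). countable {t \<in> T. f t \<noteq> 0}}"

text \<open>
  Here \<open>T\<close> may be any set in mathematics, but a definition cannot quantify over the type of its
  elements. Index sets of type \<^typ>\<open>('a \<Rightarrow> real) set\<close> suffice, as
  \<open>Sigma_subsetI\<close> below shows: an embedding has at most as many distinct coordinate functions as
  there are elements of \<^typ>\<open>'a \<Rightarrow> real\<close>, and of each of them it suffices to keep one
  copy, or continuum many copies if the function occurs uncountably often.
\<close>

definition Sigma_subset :: "'a topology \<Rightarrow> 'a set \<Rightarrow> bool"
  where "Sigma_subset X Y \<longleftrightarrow>
    (\<exists>(T :: ('a \<Rightarrow> real) set) \<phi>. embedding_map X (powertop_real T) \<phi> \<and>
       Y = {x \<in> topspace X. \<phi> x \<in> Sigma_product T})"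

definition dense_in_space :: "'a topology \<Rightarrow> 'a set \<Rightarrow> bool"
  where "dense_in_space X Y \<longleftrightarrow> Y \<subseteq> topspace X \<and> X closure_of Y = topspace X"

definition Valdivia :: "'a topology \<Rightarrow> bool"
  where "Valdivia X \<longleftrightarrow>
    compact_space X \<and> Hausdorff_space X \<and> (\<exists>Y. dense_in_space X Y \<and> Sigma_subset X Y)"

definition omega_monotone :: "'a set \<Rightarrow> 'b set \<Rightarrow> ('a set \<Rightarrow> 'b set) \<Rightarrow> bool"
  where "omega_monotone S S' \<phi> \<longleftrightarrow>
    \<phi> \<in> countable_subsets S \<rightarrow> countable_subsets S' \<and>
    (\<forall>A\<in>countable_subsets S. \<forall>B\<in>countable_subsets S. A \<subseteq> B \<longrightarrow> \<phi> A \<subseteq> \<phi> B) \<and>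
    (\<forall>A :: nat \<Rightarrow> 'a set. range A \<subseteq> countable_subsets S \<longrightarrow> incseq A \<longrightarrow>
       \<phi> (\<Union>n. A n) = (\<Union>n. \<phi> (A n)))"

definition network_of :: "'a set \<Rightarrow> 'b topology \<Rightarrow> ('a \<Rightarrow> 'b) \<Rightarrow> 'a set set \<Rightarrow> bool"
  where "network_of Z W f \<N> \<longleftrightarrow> \<N> \<subseteq> Pow Z \<and>
    (\<forall>z\<in>Z. \<forall>U. openin W U \<and> f z \<in> U \<longrightarrow> (\<exists>N\<in>\<N>. z \<in> N \<and> f ` N \<subseteq> U))"

definition monotone_retractions ::
    "'a topology \<Rightarrow> 'a set \<Rightarrow> ('a set \<Rightarrow> 'a \<Rightarrow> 'a) \<Rightarrow> ('a set \<Rightarrow> 'a set set) \<Rightarrow> bool"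
  where "monotone_retractions X Y r \<O> \<longleftrightarrow>
    (\<forall>A\<in>countable_subsets Y.
       retraction_to X Y (r A) \<and> A \<subseteq> r A ` topspace X \<and>
       network_of Y (subtopology X Y) (r A) (\<O> A)) \<and>
    omega_monotone Y (Pow Y) \<O>"

definition monotonically_retractable :: "'a topology \<Rightarrow> 'a set \<Rightarrow> bool"
  where "monotonically_retractable X Y \<longleftrightarrow>
    Y \<subseteq> topspace X \<and> (\<exists>r \<O>. monotone_retractions X Y r \<O>)"

definition commutatively_monotonically_retractable :: "'a topology \<Rightarrow> 'a set \<Rightarrow> bool"
  where "commutatively_monotonically_retractable X Y \<longleftrightarrow>
    Y \<subseteq> topspace X \<and>
    (\<exists>r \<O>. monotone_retractions X Y r \<O> \<and>
       (\<forall>A\<in>countable_subsets Y. \<forall>B\<in>countable_subsets Y. \<forall>x\<in>topspace X.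
          r A (r B x) = r B (r A x)))"

lemma embedding_map_from_composition:
  assumes f: "continuous_map X Y f" and g: "continuous_map Y Z g"
    and h: "embedding_map X Z h" and gf: "\<And>x. x \<in> topspace X \<Longrightarrow> g (f x) = h x"
  shows "embedding_map X Y f"
proof -
  obtain k where k: "homeomorphic_maps X (subtopology Z (h ` topspace X)) h k"
    using h unfolding embedding_map_def homeomorphic_map_maps by blast
  have "continuous_map (subtopology Y (f ` topspace X)) (subtopology Z (h ` topspace X)) g"
    by (rule continuous_map_into_subtopology)
       (use g gf in \<open>auto intro: continuous_map_from_subtopology\<close>)
  then have "continuous_map (subtopology Y (f ` topspace X)) X (k \<circ> g)"
    using k continuous_map_compose unfolding homeomorphic_maps_def by blast
  moreover have "continuous_map X (subtopology Y (f ` topspace X)) f"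
    using f by (simp add: continuous_map_in_subtopology)
  ultimately have "homeomorphic_maps X (subtopology Y (f ` topspace X)) f (k \<circ> g)"
    using k gf unfolding homeomorphic_maps_def by auto
  then show ?thesis
    unfolding embedding_map_def homeomorphic_map_maps by blast
qed

lemma ex_inj_real_pair:
  includes cardinal_syntax
  shows "\<exists>p :: real \<times> real \<Rightarrow> real. inj p"
proof -
  have "infinite (UNIV :: real set)"
    by (rule infinite_UNIV_char_0)
  then have "|(UNIV :: real set) \<times> (UNIV :: real set)| \<le>o |UNIV :: real set|"
    using card_of_Times_same_infinite ordIso_imp_ordLeq by blast
  then obtain p :: "real \<times> real \<Rightarrow> real" where "inj_on p (UNIV \<times> UNIV)"
    unfolding card_of_ordLeq[symmetric] by blast
  then show ?thesis by auto
qed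

lemma Sigma_subsetI:
  fixes T :: "'i set" and X :: "'a topology"
  assumes emb: "embedding_map X (powertop_real T) \<phi>"
  shows "Sigma_subset X {x \<in> topspace X. \<phi> x \<in> Sigma_product T}"
proof -
  obtain p :: "real \<times> real \<Rightarrow> real" where p: "inj p"
    using ex_inj_real_pair by blast
  define g :: "('a \<Rightarrow> real) \<times> real \<Rightarrow> 'a \<Rightarrow> real" where "g = (\<lambda>(f, r) x. p (f x, r))"
  have g: "inj g"
    by (rule injI) (auto simp: g_def fun_eq_iff inj_eq[OF p])
  define c where "c t = restrict (\<lambda>x. \<phi> x t) (topspace X)" for t
  define D where "D f = {t \<in> T. c t = f}" for f
  define J where "J = {(f, r :: real). f \<in> c ` T \<and> (r = 0 \<or> uncountable (D f))}"
  define T' where "T' = g ` J"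
  define \<phi>' where "\<phi>' x = (\<lambda>j\<in>T'. fst (inv g j) x)" for x
  define \<psi> where "\<psi> y = (\<lambda>t\<in>T. y (g (c t, 0)))" for y :: "('a \<Rightarrow> real) \<Rightarrow> real"
  have ig [simp]: "inv g (g q) = q" for q
    using g by simp
  have cJ: "(c t, 0) \<in> J" if "t \<in> T" for t
    using that by (auto simp: J_def)
  have \<phi>c: "continuous_map X (powertop_real T) \<phi>"
    using emb unfolding embedding_map_def
    using continuous_map_in_subtopology homeomorphic_imp_continuous_map by blast
  then have ct: "continuous_map X euclideanreal (\<lambda>x. \<phi> x t)" if "t \<in> T" for t
    using that by (auto simp: continuous_map_componentwise)
  have ct': "continuous_map X euclideanreal (c t)" if "t \<in> T" for t
    by (rule continuous_map_eq[OF ct[OF that]]) (simp add: c_def)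
  have "continuous_map X (powertop_real T') \<phi>'"
    unfolding continuous_map_componentwise
  proof (intro conjI ballI)
    show "\<phi>' ` topspace X \<subseteq> extensional T'"
      by (auto simp: \<phi>'_def)
  next
    fix j assume j: "j \<in> T'"
    then obtain t r where "t \<in> T" "j = g (c t, r)"
      by (auto simp: T'_def J_def)
    then show "continuous_map X euclideanreal (\<lambda>x. \<phi>' x j)"
      using j ct' by (simp add: \<phi>'_def)
  qed
  moreover have "continuous_map (powertop_real T') (powertop_real T) \<psi>"
    unfolding continuous_map_componentwise
  proof (intro conjI ballI)
    show "\<psi> ` topspace (powertop_real T') \<subseteq> extensional T"
      by (auto simp: \<psi>_def)
  next
    fix t assume t: "t \<in> T"
    then have "continuous_map (powertop_real T') euclideanreal (\<lambda>y. y (g (c t, 0)))"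
      using cJ by (intro continuous_map_product_projection) (auto simp: T'_def)
    then show "continuous_map (powertop_real T') euclideanreal (\<lambda>y. \<psi> y t)"
      using t by (simp add: \<psi>_def)
  qed
  moreover have "\<psi> (\<phi>' x) = \<phi> x" if x: "x \<in> topspace X" for x
  proof -
    have "\<phi> x \<in> extensional T"
      using \<phi>c x by (auto simp: continuous_map_componentwise)
    moreover have "\<psi> (\<phi>' x) t = \<phi> x t" if "t \<in> T" for t
      using that cJ x by (auto simp: \<psi>_def \<phi>'_def T'_def c_def)
    ultimately show ?thesis
      by (intro extensionalityI[of _ T]) (auto simp: \<psi>_def)
  qed
  ultimately have emb': "embedding_map X (powertop_real T') \<phi>'"
    using embedding_map_from_composition emb by blast
  have "\<phi>' x \<in> Sigma_product T' \<longleftrightarrow> \<phi> x \<in> Sigma_product T" if x: "x \<in> topspace X" for x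
  proof -
    let ?N = "{t \<in> T. \<phi> x t \<noteq> 0}" and ?N' = "{j \<in> T'. \<phi>' x j \<noteq> 0}"
    have top: "\<phi>' x \<in> topspace (powertop_real T')" "\<phi> x \<in> topspace (powertop_real T)"
      using \<open>continuous_map X (powertop_real T') \<phi>'\<close> \<phi>c x
      by (auto simp: continuous_map_def Pi_iff)
    have N': "?N' = g ` {(f, r) \<in> J. f x \<noteq> 0}"
      by (auto simp: T'_def \<phi>'_def inj_eq[OF g])
    have DN: "D f \<subseteq> ?N" if f: "f \<in> c ` ?N" for f
    proof
      fix t assume "t \<in> D f"
      then have t: "t \<in> T" "c t = f"
        by (auto simp: D_def)
      obtain s where s: "s \<in> ?N" "f = c s"
        using f by blast
      have "c t x = c s x"
        using t s by simp
      then have "\<phi> x t = \<phi> x s"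
        using x by (simp add: c_def)
      then show "t \<in> ?N"
        using t s by simp
    qed
    have ND: "?N \<subseteq> (\<Union>f \<in> c ` ?N. D f)"
      by (auto simp: D_def)
    have "countable ?N'" if "countable ?N"
    proof -
      have "countable (D f)" if "f \<in> c ` ?N" for f
        by (rule countable_subset[OF DN[OF that] \<open>countable ?N\<close>])
      moreover have "f \<in> c ` ?N" if "(f, r) \<in> J" "f x \<noteq> 0" for f r
        using that x by (auto simp: J_def c_def)
      ultimately have "{(f, r) \<in> J. f x \<noteq> 0} \<subseteq> c ` ?N \<times> {0}"
        by (fastforce simp: J_def)
      then show ?thesis
        unfolding N' using that
        by (intro countable_image) (rule countable_subset, assumption, intro countable_SIGMA, auto)
    qed
    moreover have "countable ?N" if cN': "countable ?N'"
    proof -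
      have J': "countable {(f, r) \<in> J. f x \<noteq> 0}"
        using cN' g unfolding N' by (meson countable_image_inj_on inj_on_subset subset_UNIV)
      have cx: "c ` ?N \<subseteq> fst ` {(f, r) \<in> J. f x \<noteq> 0}"
      proof (intro image_subsetI)
        fix t assume "t \<in> ?N"
        then have "(c t, 0) \<in> {(f, r) \<in> J. f x \<noteq> 0}"
          using x cJ by (auto simp: c_def)
        then have "fst (c t, 0 :: real) \<in> fst ` {(f, r) \<in> J. f x \<noteq> 0}"
          by (rule imageI)
        then show "c t \<in> fst ` {(f, r) \<in> J. f x \<noteq> 0}"
          by (simp only: fst_conv)
      qed
      have "countable (D f)" if f: "f \<in> c ` ?N" for f
      proof (rule ccontr)
        assume "uncountable (D f)"
        then have "Pair f ` (UNIV :: real set) \<subseteq> {(f, r) \<in> J. f x \<noteq> 0}"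
          using f x by (auto simp: J_def c_def)
        then have "countable (Pair f ` (UNIV :: real set))"
          using J' countable_subset by blast
        then have "countable (UNIV :: real set)"
          by (rule countable_image_inj_on) (auto simp: inj_on_def)
        then show False
          using uncountable_UNIV_real by blast
      qed
      moreover have "countable (c ` ?N)"
        using cx J' by (meson countable_image countable_subset)
      ultimately show ?thesis
        by (intro countable_subset[OF ND] countable_UN)
    qed
    ultimately show ?thesis
      using top unfolding Sigma_product_def by blast
  qed
  then have "{x \<in> topspace X. \<phi> x \<in> Sigma_product T} = {x \<in> topspace X. \<phi>' x \<in> Sigma_product T'}"
    by blast
  then show ?thesis
    using emb' unfolding Sigma_subset_def by blast
qed

end

theory Submission
  imports Defs
begin

text \<open>
  Let \<open>Y\<close> be a dense \<open>\<Sigma>\<close>-subset of \<open>X\<close>, given by continuous real functions \<open>f t\<close>, \<open>t \<in> T\<close>, that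
  separate points. For \<open>S \<subseteq> T\<close> let truncation to \<open>S\<close> replace the coordinates outside \<open>S\<close> by \<open>0\<close>.
  Truncations commute, and those to countable \<open>S\<close> have values with countable support. The only
  problem is that the truncation of a point of \<open>X\<close> need not be in \<open>X\<close>. It is, by compactness,
  if every nonempty rational box on finitely many coordinates from \<open>S\<close> contains a point of \<open>Y\<close>
  supported in \<open>S\<close>: such points approximate it. A countable set of coordinates is enlarged to one of
  this kind by a countable closing-off, which is \<open>\<omega>\<close>-monotone, and the rational boxes on
  finitely many coordinates of the enlarged set form the required network
  (\<open>dense_Sigma_coordinates.commutatively_monotonically_retractable\<close>).

  Conversely, let \<open>r A\<close> and \<open>\<O> A\<close> be given on a dense set \<open>Y\<close>. Call \<open>A\<close> saturated if it meets
  \<open>M \<inter> N\<close> whenever \<open>M, N \<in> \<O> A\<close> meet each other. Then \<open>r A\<close> is a retraction onto the closure of \<open>A\<close>, and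
  if \<open>A\<close> is the union of saturated sets \<open>A n\<close> increasing with \<open>n\<close>, then \<open>r (A n) x\<close> converges
  to \<open>r A x\<close>. Every countable set is contained in a saturated one, in an \<open>\<omega>\<close>-monotone way, so \<open>X\<close>
  carries a commuting family \<open>q C\<close> of retractions indexed by the countable \<open>C \<subseteq> Y\<close>, with increasing
  images and continuous along increasing sequences: a commutative retractional skeleton.

  The limit of the \<open>q C\<close> over all countable \<open>C \<subseteq> S\<close> exists for every \<open>S \<subseteq> Y\<close>; call it \<open>retract S\<close>.
  It is a continuous retraction, the identity for \<open>S = Y\<close>, and it maps \<open>Y\<close> into \<open>Y\<close>,
  because it commutes with the retractions \<open>q {y}\<close>. By induction on the cardinality of \<open>S\<close>
  there is a family \<open>H S\<close> of continuous real functions that separates points with different values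
  of \<open>retract S\<close>, such that every point of \<open>Y\<close> is a zero of all but countably many of them. If \<open>S\<close>
  is countable, a countable family does. Otherwise well-order \<open>S\<close> in the type of its cardinal, let
  \<open>S a\<close> and \<open>S' a\<close> be the sets of elements up to \<open>a\<close> and strictly below \<open>a\<close>, and let
  \<open>H S\<close> consist of the differences \<open>h \<circ> retract (S a) - h \<circ> retract (S' a)\<close> with \<open>h \<in> H (S a)\<close>,
  together with \<open>H {}\<close>. Points not separated by these have equal images under all \<open>retract (S a)\<close>,
  by transfinite induction, and hence under \<open>retract S\<close>. For \<open>y \<in> Y\<close> only countably many \<open>a\<close> give
  nonzero differences at \<open>y\<close> (\<open>countable_jumps\<close>), since the new values \<open>retract (S a) y\<close> would
  otherwise form an uncountable left-separated subset of the image of \<open>q {y}\<close>, which has a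
  countable network. The family \<open>H Y\<close> embeds \<open>X\<close> into a power of the real line and maps \<open>Y\<close> into
  the \<open>\<Sigma>\<close>-product.
\<close>

section \<open>Compactness and countable closing-off\<close>

lemma compact_directed_Inter_nonempty:
  assumes "compact_space X" and "I \<noteq> {}"
    and "\<And>i. i \<in> I \<Longrightarrow> closedin X (K i)" and "\<And>i. i \<in> I \<Longrightarrow> K i \<noteq> {}"
    and dir: "\<And>i j. i \<in> I \<Longrightarrow> j \<in> I \<Longrightarrow> \<exists>k\<in>I. K k \<subseteq> K i \<inter> K j"
  shows "(\<Inter>i\<in>I. K i) \<noteq> {}"
proof -
  have lower: "\<exists>k\<in>I. K k \<subseteq> (\<Inter>i\<in>J. K i)" if "finite J" "J \<subseteq> I" for J
    using that
  proof (induction J rule: finite_induct)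
    case empty
    then show ?case
      using \<open>I \<noteq> {}\<close> by auto
  next
    case (insert j J)
    then obtain k where k: "k \<in> I" "K k \<subseteq> (\<Inter>i\<in>J. K i)"
      by auto
    then obtain l where "l \<in> I" "K l \<subseteq> K j \<inter> K k"
      using dir[of j k] insert.prems by auto
    then show ?case
      using k by auto
  qed
  have "\<Inter>\<F> \<noteq> {}" if \<F>: "finite \<F>" "\<F> \<subseteq> K ` I" for \<F>
  proof -
    obtain J where "finite J" "J \<subseteq> I" "\<F> = K ` J"
      using finite_subset_image[OF \<F>] by blast
    moreover obtain k where k: "k \<in> I" "K k \<subseteq> (\<Inter>i\<in>J. K i)"
      using lower[OF \<open>finite J\<close> \<open>J \<subseteq> I\<close>] by blast
    ultimately show ?thesis
      using assms(4)[OF \<open>k \<in> I\<close>] by blast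
  qed
  moreover have "\<forall>C\<in>K ` I. closedin X C"
    using assms(3) by blast
  ultimately show ?thesis
    using assms(1)[unfolded compact_space_fip, rule_format, of "K ` I"] by simp
qed

lemma countable_subsets_Un:
  "A \<in> countable_subsets S \<Longrightarrow> B \<in> countable_subsets S \<Longrightarrow> A \<union> B \<in> countable_subsets S"
  by (auto simp: countable_subsets_def)

lemma countable_subsets_mono:
  "A \<in> countable_subsets S \<Longrightarrow> S \<subseteq> S' \<Longrightarrow> A \<in> countable_subsets S'"
  by (auto simp: countable_subsets_def)

lemma countable_subsets_subset:
  "A \<in> countable_subsets S \<Longrightarrow> B \<subseteq> A \<Longrightarrow> B \<in> countable_subsets S"
  by (auto simp: countable_subsets_def intro: countable_subset)

lemma countable_subsets_UN:
  "(\<And>n :: nat. A n \<in> countable_subsets S) \<Longrightarrow> (\<Union>n. A n) \<in> countable_subsets S"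
  by (auto simp: countable_subsets_def)

lemma empty_in_countable_subsets [simp]: "{} \<in> countable_subsets S"
  by (simp add: countable_subsets_def)

lemma omega_monotoneD:
  assumes "omega_monotone S S' \<Phi>"
  shows omega_monotone_in: "A \<in> countable_subsets S \<Longrightarrow> \<Phi> A \<in> countable_subsets S'"
    and omega_monotone_subset:
      "A \<subseteq> B \<Longrightarrow> B \<in> countable_subsets S \<Longrightarrow> \<Phi> A \<subseteq> \<Phi> B"
    and omega_monotone_UN:
      "(\<And>n. C n \<in> countable_subsets S) \<Longrightarrow> incseq C \<Longrightarrow> \<Phi> (\<Union>n. C n) = (\<Union>n. \<Phi> (C n))"
    and omega_monotone_incseq:
      "(\<And>n. C n \<in> countable_subsets S) \<Longrightarrow> incseq C \<Longrightarrow> incseq (\<lambda>n. \<Phi> (C n))"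
proof -
  show *: "A \<subseteq> B \<Longrightarrow> B \<in> countable_subsets S \<Longrightarrow> \<Phi> A \<subseteq> \<Phi> B" for A B
    using assms countable_subsets_subset[of B S A] by (auto simp: omega_monotone_def)
  show "A \<in> countable_subsets S \<Longrightarrow> \<Phi> A \<in> countable_subsets S'"
    using assms by (auto simp: omega_monotone_def)
  show "(\<And>n. C n \<in> countable_subsets S) \<Longrightarrow> incseq C \<Longrightarrow> \<Phi> (\<Union>n. C n) = (\<Union>n. \<Phi> (C n))"
    using assms unfolding omega_monotone_def by (metis image_subsetI)
  show "(\<And>n. C n \<in> countable_subsets S) \<Longrightarrow> incseq C \<Longrightarrow> incseq (\<lambda>n. \<Phi> (C n))"
    using * by (auto simp: incseq_def)
qed

lemma omega_monotoneI:
  assumes "\<And>A. A \<in> countable_subsets S \<Longrightarrow> \<Phi> A \<in> countable_subsets S'"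
    and "\<And>A B. A \<subseteq> B \<Longrightarrow> B \<in> countable_subsets S \<Longrightarrow> \<Phi> A \<subseteq> \<Phi> B"
    and "\<And>C. (\<And>n. C n \<in> countable_subsets S) \<Longrightarrow> incseq C \<Longrightarrow> \<Phi> (\<Union>n. C n) \<subseteq> (\<Union>n. \<Phi> (C n))"
  shows "omega_monotone S S' \<Phi>"
  unfolding omega_monotone_def
proof (intro conjI allI impI ballI)
  show "\<Phi> \<in> countable_subsets S \<rightarrow> countable_subsets S'"
    using assms(1) by blast
  show "\<And>A B. B \<in> countable_subsets S \<Longrightarrow> A \<subseteq> B \<Longrightarrow> \<Phi> A \<subseteq> \<Phi> B"
    by (rule assms(2))
  fix C :: "nat \<Rightarrow> 'a set" assume C: "range C \<subseteq> countable_subsets S" "incseq C"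
  have "(\<Union>n. C n) \<in> countable_subsets S"
    using C by (intro countable_subsets_UN) auto
  then have "\<Phi> (C n) \<subseteq> \<Phi> (\<Union>n. C n)" for n
    by (intro assms(2)) auto
  then show "\<Phi> (\<Union>n. C n) = (\<Union>n. \<Phi> (C n))"
    using assms(3)[of C] C by blast
qed

lemma omega_monotone_compose:
  assumes F: "omega_monotone S S' \<Phi>" and G: "omega_monotone S' S'' \<Psi>"
  shows "omega_monotone S S'' (\<lambda>A. \<Psi> (\<Phi> A))"
proof (rule omega_monotoneI)
  fix C :: "nat \<Rightarrow> 'a set" assume C: "\<And>n. C n \<in> countable_subsets S" "incseq C"
  show "\<Psi> (\<Phi> (\<Union>n. C n)) \<subseteq> (\<Union>n. \<Psi> (\<Phi> (C n)))"
    unfolding omega_monotone_UN[OF F C]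
    by (intro equalityD1 omega_monotone_UN[OF G])
       (use C omega_monotone_in[OF F] omega_monotone_incseq[OF F C] in auto)
qed (use omega_monotone_in[OF F] omega_monotone_in[OF G]
       omega_monotone_subset[OF F] omega_monotone_subset[OF G] in auto)

lemma omega_monotone_Union:
  assumes "\<And>s. s \<in> S \<Longrightarrow> g s \<in> countable_subsets S'"
  shows "omega_monotone S S' (\<lambda>A. \<Union>a\<in>A. g a)"
  by (rule omega_monotoneI) (use assms in \<open>auto simp: countable_subsets_def\<close>)

lemma omega_monotone_square:
  assumes F: "omega_monotone S S' \<Phi>"
  shows "omega_monotone S (S' \<times> S') (\<lambda>A. \<Phi> A \<times> \<Phi> A)"
proof (rule omega_monotoneI)
  fix C :: "nat \<Rightarrow> 'a set" assume C: "\<And>n. C n \<in> countable_subsets S" "incseq C"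
  have "(a, b) \<in> (\<Union>n. \<Phi> (C n) \<times> \<Phi> (C n))" if a: "a \<in> \<Phi> (C i)" and b: "b \<in> \<Phi> (C j)" for a b i j
  proof -
    have "\<Phi> (C i) \<subseteq> \<Phi> (C (max i j))" "\<Phi> (C j) \<subseteq> \<Phi> (C (max i j))"
      using omega_monotone_incseq[OF F C] by (auto simp: incseq_def)
    then show ?thesis
      using a b by blast
  qed
  then show "\<Phi> (\<Union>n. C n) \<times> \<Phi> (\<Union>n. C n) \<subseteq> (\<Union>n. \<Phi> (C n) \<times> \<Phi> (C n))"
    unfolding omega_monotone_UN[OF F C] by blast
next
  fix A assume "A \<in> countable_subsets S"
  from omega_monotone_in[OF F this] show "\<Phi> A \<times> \<Phi> A \<in> countable_subsets (S' \<times> S')"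
    by (auto simp: countable_subsets_def)
next
  fix A B assume "A \<subseteq> B" "B \<in> countable_subsets S"
  from omega_monotone_subset[OF F this] show "\<Phi> A \<times> \<Phi> A \<subseteq> \<Phi> B \<times> \<Phi> B"
    by blast
qed

text \<open>
  Closing a countable set off under an operation on countable sets takes \<open>\<omega>\<close> steps, and each finite
  stage is \<open>\<omega>\<close>-monotone, so the union of the stages is too. In both directions of the theorem this
  yields index sets that are closed enough to carry a well-behaved retraction.
\<close>

lemma omega_monotone_closing_off:
  assumes F: "omega_monotone S S \<Phi>"
  shows "\<exists>\<Psi>. omega_monotone S S \<Psi> \<and>
    (\<forall>A\<in>countable_subsets S. A \<subseteq> \<Psi> A \<and> \<Phi> (\<Psi> A) \<subseteq> \<Psi> A)"
proof -
  define J where "J n = ((\<lambda>A. A \<union> \<Phi> A) ^^ n)" for n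
  have J0: "J 0 A = A" and JSuc: "J (Suc n) A = J n A \<union> \<Phi> (J n A)" for n A
    by (auto simp: J_def)
  have J: "omega_monotone S S (J n)" for n
  proof (induction n)
    case 0
    show ?case
      by (rule omega_monotoneI) (auto simp: J0)
  next
    case (Suc n)
    note K = omega_monotone_compose[OF Suc F]
    show ?case
    proof (rule omega_monotoneI)
      fix C :: "nat \<Rightarrow> 'a set" assume C: "\<And>n. C n \<in> countable_subsets S" "incseq C"
      show "J (Suc n) (\<Union>n. C n) \<subseteq> (\<Union>m. J (Suc n) (C m))"
        unfolding JSuc unfolding omega_monotone_UN[OF K C] unfolding omega_monotone_UN[OF Suc C]
        by blast
    next
      fix A assume A: "A \<in> countable_subsets S"
      show "J (Suc n) A \<in> countable_subsets S"
        unfolding JSuc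
        by (intro countable_subsets_Un omega_monotone_in[OF Suc A] omega_monotone_in[OF K A])
    next
      fix A B assume AB: "A \<subseteq> B" "B \<in> countable_subsets S"
      show "J (Suc n) A \<subseteq> J (Suc n) B"
        unfolding JSuc
        by (intro Un_mono omega_monotone_subset[OF Suc AB] omega_monotone_subset[OF K AB])
    qed
  qed
  have inc: "incseq (\<lambda>n. J n A)" for A
    by (rule incseq_SucI) (auto simp: JSuc)
  have "omega_monotone S S (\<lambda>A. \<Union>n. J n A)"
  proof (rule omega_monotoneI)
    show "(\<Union>n. J n A) \<in> countable_subsets S" if "A \<in> countable_subsets S" for A
      using omega_monotone_in[OF J that] by (rule countable_subsets_UN)
    show "(\<Union>n. J n A) \<subseteq> (\<Union>n. J n B)" if "A \<subseteq> B" "B \<in> countable_subsets S" for A B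
      using omega_monotone_subset[OF J that] by blast
    show "(\<Union>n. J n (\<Union>m. C m)) \<subseteq> (\<Union>m. \<Union>n. J n (C m))"
      if C: "\<And>n. C n \<in> countable_subsets S" "incseq C" for C
      unfolding omega_monotone_UN[OF J C] by blast
  qed
  moreover have "A \<subseteq> (\<Union>n. J n A) \<and> \<Phi> (\<Union>n. J n A) \<subseteq> (\<Union>n. J n A)"
    if A: "A \<in> countable_subsets S" for A
  proof
    show "A \<subseteq> (\<Union>n. J n A)"
      using UN_upper[of 0 UNIV "\<lambda>n. J n A"] by (simp add: J0)
    have "\<Phi> (\<Union>n. J n A) = (\<Union>n. \<Phi> (J n A))"
      using omega_monotone_in[OF J A] inc by (rule omega_monotone_UN[OF F])
    also have "\<dots> \<subseteq> (\<Union>n. J n A)"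
      using JSuc by (intro UN_least order_trans[OF _ UN_upper[of "Suc _"]]) auto
    finally show "\<Phi> (\<Union>n. J n A) \<subseteq> (\<Union>n. J n A)" .
  qed
  ultimately show ?thesis
    by (intro exI[of _ "\<lambda>A. \<Union>n. J n A"]) simp
qed

lemma compact_Hausdorff_shrink_neighbourhood:
  assumes "compact_space X" "Hausdorff_space X" "openin X U" "x \<in> U"
  obtains V where "openin X V" "x \<in> V" "X closure_of V \<subseteq> U"
proof -
  have "closedin X (topspace X - U)" "x \<in> topspace X - (topspace X - U)"
    using assms(3,4) openin_subset by (auto simp: closedin_def Diff_Diff_Int Int_absorb1)
  then obtain V where V: "openin X V" "x \<in> V" "disjnt (topspace X - U) (X closure_of V)"
    using compact_Hausdorff_imp_regular_space[OF assms(1,2)] unfolding regular_space by blast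
  then have "X closure_of V \<subseteq> U"
    using closure_of_subset_topspace[of X V] unfolding disjnt_def by blast
  with V show thesis
    by (intro that)
qed

section \<open>Truncating coordinates in a Valdivia compact space\<close>

lemma finite_subset_incseq_UN:
  assumes "finite F" "F \<subseteq> (\<Union>n. C n)" "incseq C"
  shows "\<exists>n. F \<subseteq> C n"
  using assms(1,2)
proof (induction F rule: finite_induct)
  case (insert a F)
  then obtain m n where "F \<subseteq> C m" "a \<in> C n"
    by auto
  moreover have "C m \<subseteq> C (max m n)" "C n \<subseteq> C (max m n)"
    using assms(3) by (auto simp: incseq_def)
  ultimately have "insert a F \<subseteq> C (max m n)"
    by blast
  then show ?case ..
qed simp

text \<open>
  The coordinate functions of an embedding into a power of the real line, regarded as functions
  on \<open>X\<close>. As \<open>X\<close> is compact, continuous functions that separate points determine its topology.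
\<close>

locale dense_Sigma_coordinates =
  fixes X :: "'a topology" and T :: "'i set" and f :: "'i \<Rightarrow> 'a \<Rightarrow> real" and Y :: "'a set"
  assumes compact: "compact_space X"
    and coordinate: "t \<in> T \<Longrightarrow> continuous_map X euclideanreal (f t)"
    and separating:
      "x \<in> topspace X \<Longrightarrow> z \<in> topspace X \<Longrightarrow> (\<And>t. t \<in> T \<Longrightarrow> f t x = f t z) \<Longrightarrow> x = z"
    and in_Y_iff: "x \<in> Y \<longleftrightarrow> x \<in> topspace X \<and> countable {t \<in> T. f t x \<noteq> 0}"
    and dense: "X closure_of Y = topspace X"
begin

lemma subset_topspace: "Y \<subseteq> topspace X"
  by (auto simp: in_Y_iff)

definition support :: "'a \<Rightarrow> 'i set"
  where "support x = {t \<in> T. f t x \<noteq> 0}"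

lemma support_in: "y \<in> Y \<Longrightarrow> support y \<in> countable_subsets T"
  by (auto simp: in_Y_iff support_def countable_subsets_def)

text \<open>
  The prescribed values at finitely many coordinates, up to a positive error, cut out closed sets
  that are directed; a point in their intersection realizes all values exactly. This gives both
  the existence of truncated points and, in \<open>coordinate_neighbourhood\<close>, the fact that the coordinates
  determine the topology.
\<close>

lemma realize_coordinates:
  assumes K: "closedin X K"
    and approx: "\<And>F \<epsilon>. finite F \<Longrightarrow> F \<subseteq> T \<Longrightarrow> 0 < \<epsilon> \<Longrightarrow> \<exists>z\<in>K. \<forall>t\<in>F. \<bar>f t z - p t\<bar> \<le> \<epsilon>"
  shows "\<exists>z\<in>K. \<forall>t\<in>T. f t z = p t"
proof -
  define L where "L = (\<lambda>(F, n :: nat). K \<inter> (\<Inter>t\<in>F. {z \<in> topspace X. f t z \<in> cball (p t) (1 / Suc n)}))"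
  define I where "I = {F. finite F \<and> F \<subseteq> T} \<times> (UNIV :: nat set)"
  have KX: "K \<subseteq> topspace X"
    by (rule closedin_subset[OF K])
  have "(\<Inter>i\<in>I. L i) \<noteq> {}"
  proof (rule compact_directed_Inter_nonempty[OF compact])
    show "I \<noteq> {}"
      by (auto simp: I_def)
  next
    fix i assume "i \<in> I"
    then obtain F n where i: "i = (F, n)" "finite F" "F \<subseteq> T"
      by (auto simp: I_def)
    have "closedin X {z \<in> topspace X. f t z \<in> cball (p t) (1 / Suc n)}" if "t \<in> F" for t
      using coordinate[of t] that i(3) by (intro closedin_continuous_map_preimage) auto
    then show "closedin X (L i)"
      unfolding L_def i(1) prod.case
      by (cases "F = {}") (use K in \<open>auto intro!: closedin_Int closedin_INT\<close>)
    obtain z where "z \<in> K" "\<forall>t\<in>F. \<bar>f t z - p t\<bar> \<le> 1 / Suc n"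
      using approx[OF i(2,3), of "1 / Suc n"] by auto
    then have "z \<in> L i"
      using KX by (auto simp: L_def i(1) dist_real_def abs_minus_commute)
    then show "L i \<noteq> {}"
      by blast
  next
    fix i j assume "i \<in> I" "j \<in> I"
    then obtain F m G n where ij: "i = (F, m)" "j = (G, n)" "finite F" "F \<subseteq> T" "finite G" "G \<subseteq> T"
      by (auto simp: I_def)
    have "1 / real (Suc (max m n)) \<le> 1 / Suc m" "1 / real (Suc (max m n)) \<le> 1 / Suc n"
      by (auto intro!: divide_left_mono)
    then have "cball (p t) (1 / Suc (max m n)) \<subseteq> cball (p t) (1 / Suc m) \<inter> cball (p t) (1 / Suc n)" for t
      by (intro Int_greatest subset_cball) auto
    then have "L (F \<union> G, max m n) \<subseteq> L i \<inter> L j"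
      unfolding L_def ij(1,2) prod.case by blast
    moreover have "(F \<union> G, max m n) \<in> I"
      using ij by (simp add: I_def)
    ultimately show "\<exists>k\<in>I. L k \<subseteq> L i \<inter> L j"
      by blast
  qed
  then obtain z where z: "\<And>i. i \<in> I \<Longrightarrow> z \<in> L i"
    by blast
  have "f t z = p t" if "t \<in> T" for t
  proof (rule ccontr)
    assume "f t z \<noteq> p t"
    then obtain n where n: "1 / Suc n < dist (p t) (f t z)"
      using nat_approx_posE[of "dist (p t) (f t z)"] by auto
    have "({t}, n) \<in> I"
      using that by (simp add: I_def)
    then have "z \<in> L ({t}, n)"
      by (rule z)
    then show False
      using n by (simp add: L_def)
  qed
  moreover have "z \<in> K"
    using z[of "({}, 0)"] by (simp add: I_def L_def)
  ultimately show ?thesis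
    by blast
qed

text \<open>
  If no finite set of coordinates worked, then by compactness some point outside \<open>U\<close> would have the
  same coordinates as \<open>x\<close>.
\<close>

lemma coordinate_neighbourhood:
  assumes U: "openin X U" and x: "x \<in> U"
  obtains F \<epsilon> where "finite F" "F \<subseteq> T" "0 < \<epsilon>"
    and "\<And>z. z \<in> topspace X \<Longrightarrow> (\<And>t. t \<in> F \<Longrightarrow> \<bar>f t z - f t x\<bar> \<le> \<epsilon>) \<Longrightarrow> z \<in> U"
proof (rule ccontr)
  note found = that
  assume no: "\<not> thesis"
  have "\<exists>z\<in>topspace X - U. \<forall>t\<in>F. \<bar>f t z - f t x\<bar> \<le> \<epsilon>" if F: "finite F" "F \<subseteq> T" "0 < \<epsilon>" for F \<epsilon>
  proof (rule ccontr)
    assume "\<not> ?thesis"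
    then have "z \<in> U" if "z \<in> topspace X" "\<And>t. t \<in> F \<Longrightarrow> \<bar>f t z - f t x\<bar> \<le> \<epsilon>" for z
      using that by blast
    then show False
      using no found[OF F] by blast
  qed
  then obtain z where z: "z \<in> topspace X - U" "\<forall>t\<in>T. f t z = f t x"
    using realize_coordinates[of "topspace X - U" "\<lambda>t. f t x"] U by blast
  then have "z = x"
    using openin_subset[OF U] x by (intro separating) auto
  then show False
    using z(1) x by blast
qed

lemma openin_coordinate_box:
  assumes "finite F" "F \<subseteq> T"
  shows "openin X {z \<in> topspace X. \<forall>t\<in>F. \<bar>f t z - g t\<bar> < \<epsilon>}"
  using assms
proof (induction F rule: finite_induct)
  case (insert t F)
  have "openin X {z \<in> topspace X. f t z \<in> ball (g t) \<epsilon>}"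
    using coordinate[of t] insert.prems by (intro openin_continuous_map_preimage) auto
  then have "openin X ({z \<in> topspace X. f t z \<in> ball (g t) \<epsilon>} \<inter>
      {z \<in> topspace X. \<forall>t\<in>F. \<bar>f t z - g t\<bar> < \<epsilon>})"
    using insert by (intro openin_Int) auto
  also have "{z \<in> topspace X. f t z \<in> ball (g t) \<epsilon>} \<inter> {z \<in> topspace X. \<forall>t\<in>F. \<bar>f t z - g t\<bar> < \<epsilon>} =
      {z \<in> topspace X. \<forall>t\<in>insert t F. \<bar>f t z - g t\<bar> < \<epsilon>}"
    by (auto simp: dist_real_def abs_minus_commute)
  finally show ?case .
qed simp

definition rational_box :: "'i set \<Rightarrow> ('i \<Rightarrow> real) \<Rightarrow> nat \<Rightarrow> 'a set"
  where "rational_box F g n = {y \<in> Y. \<forall>t\<in>F. \<bar>f t y - g t\<bar> < 1 / Suc n}"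

definition boxes :: "'i set \<Rightarrow> 'a set set"
  where "boxes S = (\<Union>F\<in>{F. finite F \<and> F \<subseteq> S}. (\<lambda>(g, n). rational_box F g n) ` ((F \<rightarrow>\<^sub>E \<rat>) \<times> UNIV))"

lemma omega_monotone_boxes: "omega_monotone T (Pow Y) boxes"
proof (rule omega_monotoneI)
  fix S assume S: "S \<in> countable_subsets T"
  have "countable (boxes S)"
    unfolding boxes_def
  proof (intro countable_UN countable_image countable_SIGMA)
    show "countable {F. finite F \<and> F \<subseteq> S}"
      using S by (intro countable_Collect_finite_subset) (simp add: countable_subsets_def)
    show "countable (F \<rightarrow>\<^sub>E (\<rat> :: real set))" if "F \<in> {F. finite F \<and> F \<subseteq> S}" for F
      using that by (intro countable_PiE countable_rat) auto
  qed auto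
  then show "boxes S \<in> countable_subsets (Pow Y)"
    by (auto simp: countable_subsets_def boxes_def rational_box_def)
next
  show "boxes S \<subseteq> boxes S'" if "S \<subseteq> S'" for S S'
    unfolding boxes_def using that by (intro UN_mono) auto
next
  fix C :: "nat \<Rightarrow> 'i set" assume C: "\<And>n. C n \<in> countable_subsets T" "incseq C"
  show "boxes (\<Union>n. C n) \<subseteq> (\<Union>n. boxes (C n))"
  proof
    fix N assume "N \<in> boxes (\<Union>n. C n)"
    then obtain F where F: "finite F" "F \<subseteq> (\<Union>n. C n)"
      and N: "N \<in> (\<lambda>(g, n). rational_box F g n) ` ((F \<rightarrow>\<^sub>E \<rat>) \<times> UNIV)"
      unfolding boxes_def by blast
    obtain n where "F \<subseteq> C n"
      using finite_subset_incseq_UN[OF F C(2)] by blast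
    then have "N \<in> boxes (C n)"
      unfolding boxes_def using F(1) N by blast
    then show "N \<in> (\<Union>n. boxes (C n))"
      by blast
  qed
qed

text \<open>
  The centre \<open>g\<close> is a rational approximation of the coordinates of \<open>x\<close>. The point \<open>x\<close> itself need not be in
  \<open>Y\<close>, hence not in the box, so its closeness to \<open>g\<close> is stated separately.
\<close>

lemma small_box:
  assumes F: "finite F" "F \<subseteq> S" and \<epsilon>: "0 < \<epsilon>"
  obtains g n where "rational_box F g n \<in> boxes S" and "\<And>t. t \<in> F \<Longrightarrow> \<bar>f t x - g t\<bar> < 1 / Suc n"
    and "\<And>y t. y \<in> rational_box F g n \<Longrightarrow> t \<in> F \<Longrightarrow> \<bar>f t y - f t x\<bar> \<le> \<epsilon>"
proof -
  obtain n where n: "1 / Suc n < \<epsilon> / 2"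
    using nat_approx_posE[of "\<epsilon> / 2"] \<epsilon> by auto
  have "\<exists>s\<in>\<rat>. \<bar>f t x - s\<bar> < 1 / Suc n" for t
  proof -
    obtain s where "s \<in> \<rat>" "f t x < s" "s < f t x + 1 / Suc n"
      using Rats_dense_in_real[of "f t x" "f t x + 1 / Suc n"] by auto
    then show ?thesis
      by (intro bexI[of _ s]) auto
  qed
  then obtain g where g: "\<And>t. g t \<in> \<rat>" "\<And>t. \<bar>f t x - g t\<bar> < 1 / Suc n"
    by metis
  show thesis
  proof
    have "restrict g F \<in> F \<rightarrow>\<^sub>E \<rat>"
      using g(1) by simp
    then show "rational_box F (restrict g F) n \<in> boxes S"
      unfolding boxes_def using F
      by (intro UN_I[of F] image_eqI[of _ _ "(restrict g F, n)"]) auto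
    show "\<bar>f t x - restrict g F t\<bar> < 1 / Suc n" if "t \<in> F" for t
      using g(2)[of t] that by simp
    show "\<bar>f t y - f t x\<bar> \<le> \<epsilon>" if "y \<in> rational_box F (restrict g F) n" "t \<in> F" for y t
    proof -
      have "\<bar>f t y - g t\<bar> < 1 / Suc n"
        using that by (simp add: rational_box_def)
      then show ?thesis
        using g(2)[of t] n by linarith
    qed
  qed
qed

text \<open>
  The boxes on finitely many coordinates in \<open>S\<close> already meet \<open>Y\<close> in points supported in \<open>S\<close>, if they
  meet it at all. This is why truncation to \<open>S\<close> does not leave \<open>X\<close>.
\<close>

definition admissible :: "'i set \<Rightarrow> bool"
  where "admissible S \<longleftrightarrow> S \<in> countable_subsets T \<and>
    (\<forall>N\<in>boxes S. N \<noteq> {} \<longrightarrow> (\<exists>y\<in>N. support y \<subseteq> S))"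

definition truncate :: "'i set \<Rightarrow> 'a \<Rightarrow> 'a"
  where "truncate S x =
    (SOME z. z \<in> topspace X \<and> (\<forall>t\<in>T. f t z = (if t \<in> S then f t x else 0)))"

text \<open>
  A basic neighbourhood of the truncated point restricts finitely many coordinates. On those in \<open>S\<close>
  it is met by a rational box around \<open>x\<close>, which contains points of \<open>Y\<close> by density and then one
  supported in \<open>S\<close> by admissibility; the latter has the right coordinates, namely \<open>0\<close>, outside \<open>S\<close> as well.
\<close>

lemma truncate:
  assumes S: "admissible S" and x: "x \<in> topspace X"
  shows truncate_in_topspace: "truncate S x \<in> topspace X"
    and truncate_coordinate: "t \<in> T \<Longrightarrow> f t (truncate S x) = (if t \<in> S then f t x else 0)"
proof -
  let ?p = "\<lambda>t. if t \<in> S then f t x else 0"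
  have ST: "S \<subseteq> T"
    using S by (simp add: admissible_def countable_subsets_def)
  have "\<exists>z\<in>topspace X. \<forall>t\<in>F. \<bar>f t z - ?p t\<bar> \<le> \<epsilon>" if F: "finite F" "F \<subseteq> T" and \<epsilon>: "0 < \<epsilon>" for F \<epsilon>
  proof -
    have fin: "finite (F \<inter> S)" "F \<inter> S \<subseteq> S" "F \<inter> S \<subseteq> T"
      using F by auto
    obtain g n where N: "rational_box (F \<inter> S) g n \<in> boxes S"
      and g: "\<And>t. t \<in> F \<inter> S \<Longrightarrow> \<bar>f t x - g t\<bar> < 1 / Suc n"
      and small: "\<And>y t. y \<in> rational_box (F \<inter> S) g n \<Longrightarrow> t \<in> F \<inter> S \<Longrightarrow> \<bar>f t y - f t x\<bar> \<le> \<epsilon>"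
      using small_box[OF fin(1,2) \<epsilon>, of x] by blast
    \<comment> \<open>Density gives points of \<open>Y\<close> in the box although \<open>x\<close> itself may lie outside \<open>Y\<close>.\<close>
    define B where "B = {z \<in> topspace X. \<forall>t\<in>F \<inter> S. \<bar>f t z - g t\<bar> < 1 / Suc n}"
    have "openin X B" "x \<in> B"
      using openin_coordinate_box[OF fin(1,3)] x g by (auto simp: B_def)
    then obtain y where "y \<in> Y" "y \<in> B"
      using dense unfolding dense_intersects_open by blast
    then have "rational_box (F \<inter> S) g n \<noteq> {}"
      by (auto simp: rational_box_def B_def)
    then obtain y where y: "y \<in> rational_box (F \<inter> S) g n" "support y \<subseteq> S"
      using S N unfolding admissible_def by blast
    have "\<bar>f t y - ?p t\<bar> \<le> \<epsilon>" if "t \<in> F" for t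
      using small[OF y(1), of t] y(2) that F(2) \<epsilon> by (cases "t \<in> S") (auto simp: support_def)
    moreover have "y \<in> topspace X"
      using y(1) subset_topspace by (auto simp: rational_box_def)
    ultimately show ?thesis
      by blast
  qed
  then have "\<exists>z\<in>topspace X. \<forall>t\<in>T. f t z = ?p t"
    by (intro realize_coordinates) auto
  then have "\<exists>z. z \<in> topspace X \<and> (\<forall>t\<in>T. f t z = ?p t)"
    by blast
  from someI_ex[OF this]
  have *: "truncate S x \<in> topspace X \<and> (\<forall>t\<in>T. f t (truncate S x) = ?p t)"
    unfolding truncate_def .
  show "truncate S x \<in> topspace X"
    using * by blast
  show "t \<in> T \<Longrightarrow> f t (truncate S x) = ?p t"
    using * by blast
qed

lemma truncate_in_Y:
  assumes S: "admissible S" and x: "x \<in> topspace X"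
  shows "truncate S x \<in> Y"
proof -
  have "{t \<in> T. f t (truncate S x) \<noteq> 0} \<subseteq> S"
    using truncate_coordinate[OF S x] by (auto split: if_splits)
  then show ?thesis
    using truncate_in_topspace[OF S x] S countable_subset
    by (auto simp: in_Y_iff admissible_def countable_subsets_def)
qed

lemma truncate_fixes:
  assumes S: "admissible S" and y: "y \<in> topspace X" "support y \<subseteq> S"
  shows "truncate S y = y"
  using truncate_in_topspace[OF S y(1)] truncate_coordinate[OF S y(1)] y
  by (intro separating) (auto simp: support_def)

lemma truncate_commute:
  assumes S: "admissible S" "admissible S'" and x: "x \<in> topspace X"
  shows "truncate S (truncate S' x) = truncate S' (truncate S x)"
  using assms by (intro separating) (auto simp: truncate_in_topspace truncate_coordinate)

text \<open>
  A neighbourhood of the truncated point restricts the truncated coordinates, and these only depend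
  on the coordinates in \<open>S\<close>. Continuity and the network property both follow.
\<close>

lemma truncate_local:
  assumes S: "admissible S" and x: "x \<in> topspace X" and U: "openin X U" "truncate S x \<in> U"
  obtains F \<epsilon> where "finite F" "F \<subseteq> S" "0 < \<epsilon>"
    and "\<And>z. z \<in> topspace X \<Longrightarrow> (\<And>t. t \<in> F \<Longrightarrow> \<bar>f t z - f t x\<bar> \<le> \<epsilon>) \<Longrightarrow> truncate S z \<in> U"
proof -
  obtain F \<epsilon> where F: "finite F" "F \<subseteq> T" "0 < \<epsilon>"
    and near: "\<And>z. z \<in> topspace X \<Longrightarrow> (\<And>t. t \<in> F \<Longrightarrow> \<bar>f t z - f t (truncate S x)\<bar> \<le> \<epsilon>) \<Longrightarrow> z \<in> U"
    using coordinate_neighbourhood[OF U] by blast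
  show thesis
  proof
    show "finite (F \<inter> S)" "F \<inter> S \<subseteq> S" "0 < \<epsilon>"
      using F by auto
    fix z assume z: "z \<in> topspace X" and close: "\<And>t. t \<in> F \<inter> S \<Longrightarrow> \<bar>f t z - f t x\<bar> \<le> \<epsilon>"
    show "truncate S z \<in> U"
    proof (rule near[OF truncate_in_topspace[OF S z]])
      fix t assume "t \<in> F"
      then have "t \<in> T"
        using F(2) by blast
      then show "\<bar>f t (truncate S z) - f t (truncate S x)\<bar> \<le> \<epsilon>"
        using close[of t] \<open>t \<in> F\<close> F(3)
        by (simp add: truncate_coordinate[OF S x] truncate_coordinate[OF S z])
    qed
  qed
qed

lemma retraction_truncate:
  assumes S: "admissible S"
  shows "retraction_to X Y (truncate S)"
  unfolding retraction_to_def
proof (intro conjI ballI)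
  show "truncate S ` topspace X \<subseteq> Y"
    using truncate_in_Y[OF S] by blast
  show "truncate S (truncate S x) = truncate S x" if x: "x \<in> topspace X" for x
    using truncate_in_topspace[OF S x] truncate_coordinate[OF S x]
    by (intro truncate_fixes[OF S]) (auto simp: support_def split: if_splits)
  show "continuous_map X X (truncate S)"
    unfolding continuous_map_def
  proof (intro conjI allI impI)
    show "truncate S \<in> topspace X \<rightarrow> topspace X"
      using truncate_in_topspace[OF S] by blast
    fix U assume U: "openin X U"
    show "openin X {x \<in> topspace X. truncate S x \<in> U}"
    proof (subst openin_subopen, intro ballI)
      fix x assume "x \<in> {x \<in> topspace X. truncate S x \<in> U}"
      then have x: "x \<in> topspace X" "truncate S x \<in> U"
        by auto
      obtain F \<epsilon> where F: "finite F" "F \<subseteq> S" "0 < \<epsilon>"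
        and near: "\<And>z. z \<in> topspace X \<Longrightarrow> (\<And>t. t \<in> F \<Longrightarrow> \<bar>f t z - f t x\<bar> \<le> \<epsilon>) \<Longrightarrow> truncate S z \<in> U"
        using truncate_local[OF S x(1) U x(2)] by blast
      let ?V = "{z \<in> topspace X. \<forall>t\<in>F. \<bar>f t z - f t x\<bar> < \<epsilon>}"
      have "F \<subseteq> T"
        using F(2) S by (auto simp: admissible_def countable_subsets_def)
      then have "openin X ?V"
        by (rule openin_coordinate_box[OF F(1)])
      moreover have "?V \<subseteq> {x \<in> topspace X. truncate S x \<in> U}"
        using near less_imp_le by blast
      moreover have "x \<in> ?V"
        using x F(3) by simp
      ultimately show "\<exists>V. openin X V \<and> x \<in> V \<and> V \<subseteq> {x \<in> topspace X. truncate S x \<in> U}"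
        by blast
    qed
  qed
qed

lemma network_truncate:
  assumes S: "admissible S"
  shows "network_of Y (subtopology X Y) (truncate S) (boxes S)"
  unfolding network_of_def
proof (intro conjI ballI allI impI)
  show "boxes S \<subseteq> Pow Y"
    by (auto simp: boxes_def rational_box_def)
  fix y U assume y: "y \<in> Y" and "openin (subtopology X Y) U \<and> truncate S y \<in> U"
  then obtain V where V: "openin X V" "truncate S y \<in> V" "U = V \<inter> Y"
    by (auto simp: openin_subtopology)
  have yX: "y \<in> topspace X"
    using y subset_topspace by blast
  obtain F \<epsilon> where F: "finite F" "F \<subseteq> S" "0 < \<epsilon>"
    and near: "\<And>z. z \<in> topspace X \<Longrightarrow> (\<And>t. t \<in> F \<Longrightarrow> \<bar>f t z - f t y\<bar> \<le> \<epsilon>) \<Longrightarrow> truncate S z \<in> V"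
    using truncate_local[OF S yX V(1,2)] by blast
  obtain g n where N: "rational_box F g n \<in> boxes S"
    and g: "\<And>t. t \<in> F \<Longrightarrow> \<bar>f t y - g t\<bar> < 1 / Suc n"
    and small: "\<And>z t. z \<in> rational_box F g n \<Longrightarrow> t \<in> F \<Longrightarrow> \<bar>f t z - f t y\<bar> \<le> \<epsilon>"
    using small_box[OF F, of y] by blast
  have "y \<in> rational_box F g n"
    using y g by (simp add: rational_box_def)
  moreover have "truncate S z \<in> U" if z: "z \<in> rational_box F g n" for z
  proof -
    have "z \<in> topspace X"
      using z subset_topspace by (auto simp: rational_box_def)
    then show ?thesis
      using near small[OF z] truncate_in_Y[OF S] V(3) by blast
  qed
  ultimately show "\<exists>N\<in>boxes S. y \<in> N \<and> truncate S ` N \<subseteq> U"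
    using N by blast
qed

lemma commutatively_monotonically_retractable: "commutatively_monotonically_retractable X Y"
proof -
  define c where "c N = (SOME y. y \<in> N)" for N :: "'a set"
  define g where "g N = (if N = {} then {} else support (c N))" for N
  have c: "c N \<in> N" if "N \<noteq> {}" for N
    unfolding c_def using that by (simp add: some_in_eq)
  have "g N \<in> countable_subsets T" if "N \<in> Pow Y" for N
    using that c[of N] support_in[of "c N"] by (auto simp: g_def)
  from omega_monotone_closing_off[OF omega_monotone_compose[OF
      omega_monotone_boxes omega_monotone_Union[OF this]]]
  obtain \<Psi> where \<Psi>_cl: "omega_monotone T T \<Psi> \<and>
    (\<forall>S\<in>countable_subsets T. S \<subseteq> \<Psi> S \<and> (\<Union>N\<in>boxes (\<Psi> S). g N) \<subseteq> \<Psi> S)" ..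
  note \<Psi> = conjunct1[OF \<Psi>_cl]
  have ext: "S \<subseteq> \<Psi> S" and closed: "(\<Union>N\<in>boxes (\<Psi> S). g N) \<subseteq> \<Psi> S"
    if "S \<in> countable_subsets T" for S
    using bspec[OF conjunct2[OF \<Psi>_cl] that] by simp_all
  have adm: "admissible (\<Psi> S)" if S: "S \<in> countable_subsets T" for S
    unfolding admissible_def
  proof (intro conjI ballI impI)
    show "\<Psi> S \<in> countable_subsets T"
      by (rule omega_monotone_in[OF \<Psi> S])
    fix N assume N: "N \<in> boxes (\<Psi> S)" "N \<noteq> {}"
    then have "support (c N) \<subseteq> \<Psi> S"
      using closed[OF S] by (auto simp: g_def)
    then show "\<exists>y\<in>N. support y \<subseteq> \<Psi> S"
      using c[OF N(2)] by blast
  qed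
  have supp: "omega_monotone Y T (\<lambda>A. \<Union>a\<in>A. support a)"
    using support_in by (rule omega_monotone_Union)
  define s where "s A = \<Psi> (\<Union>a\<in>A. support a)" for A
  have s: "omega_monotone Y T s"
    using omega_monotone_compose[OF supp \<Psi>] by (simp add: s_def[abs_def])
  have adm_s: "admissible (s A)" if "A \<in> countable_subsets Y" for A
    unfolding s_def by (rule adm[OF omega_monotone_in[OF supp that]])
  have image: "A \<subseteq> truncate (s A) ` topspace X" if A: "A \<in> countable_subsets Y" for A
  proof
    fix a assume a: "a \<in> A"
    have "support a \<subseteq> s A"
      using ext[OF omega_monotone_in[OF supp A]] a by (auto simp: s_def)
    moreover have aX: "a \<in> topspace X"
      using a A subset_topspace by (auto simp: countable_subsets_def)
    ultimately have "a = truncate (s A) a"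
      using truncate_fixes[OF adm_s[OF A]] by simp
    then show "a \<in> truncate (s A) ` topspace X"
      using aX by (rule image_eqI)
  qed
  have "monotone_retractions X Y (\<lambda>A. truncate (s A)) (\<lambda>A. boxes (s A))"
    unfolding monotone_retractions_def
    using retraction_truncate[OF adm_s] network_truncate[OF adm_s] image
      omega_monotone_compose[OF s omega_monotone_boxes] by simp
  moreover have "truncate (s A) (truncate (s B) x) = truncate (s B) (truncate (s A) x)"
    if "A \<in> countable_subsets Y" "B \<in> countable_subsets Y" "x \<in> topspace X" for A B x
    by (rule truncate_commute[OF adm_s[OF that(1)] adm_s[OF that(2)] that(3)])
  ultimately show ?thesis
    unfolding commutatively_monotonically_retractable_def using subset_topspace by blast
qed

end

section \<open>Commutative retractional skeletons\<close>

text \<open>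
  A variant of a commutative retractional skeleton whose index set is the family of all countable
  subsets of the set \<open>Y\<close> covered by the images. The images have countable networks, which for
  compact spaces means that they are metrizable.
\<close>

locale commutative_skeleton =
  fixes X :: "'a topology" and Y :: "'a set" and q :: "'a set \<Rightarrow> 'a \<Rightarrow> 'a"
  assumes compact: "compact_space X" and Hausdorff: "Hausdorff_space X"
    and subset_topspace: "Y \<subseteq> topspace X"
    and retraction: "C \<in> countable_subsets Y \<Longrightarrow> retraction_to X Y (q C)"
    and subset_image: "C \<in> countable_subsets Y \<Longrightarrow> C \<subseteq> q C ` topspace X"
    and image_mono:
      "C \<subseteq> D \<Longrightarrow> D \<in> countable_subsets Y \<Longrightarrow> q C ` topspace X \<subseteq> q D ` topspace X"
    and commute:
      "C \<in> countable_subsets Y \<Longrightarrow> D \<in> countable_subsets Y \<Longrightarrow> x \<in> topspace X \<Longrightarrow>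
        q C (q D x) = q D (q C x)"
    and sequence_limit:
      "(\<And>n. B n \<in> countable_subsets Y) \<Longrightarrow> incseq B \<Longrightarrow> x \<in> topspace X \<Longrightarrow>
        limitin X (\<lambda>n. q (B n) x) (q (\<Union>n. B n) x) sequentially"
    and network:
      "C \<in> countable_subsets Y \<Longrightarrow>
        \<exists>\<N>. countable \<N> \<and> network_of Y (subtopology X Y) (q C) \<N>"
begin

lemma continuous: "C \<in> countable_subsets Y \<Longrightarrow> continuous_map X X (q C)"
  using retraction by (auto simp: retraction_to_def)

lemma in_Y: "C \<in> countable_subsets Y \<Longrightarrow> x \<in> topspace X \<Longrightarrow> q C x \<in> Y"
  using retraction by (auto simp: retraction_to_def)

lemma in_topspace: "C \<in> countable_subsets Y \<Longrightarrow> x \<in> topspace X \<Longrightarrow> q C x \<in> topspace X"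
  using in_Y subset_topspace by blast

lemma image_iff:
  "C \<in> countable_subsets Y \<Longrightarrow> z \<in> q C ` topspace X \<longleftrightarrow> z \<in> topspace X \<and> q C z = z"
  using retraction[of C] in_topspace[of C] by (force simp: retraction_to_def)

lemma absorb:
  assumes "C \<subseteq> D" "D \<in> countable_subsets Y" "x \<in> topspace X"
  shows "q D (q C x) = q C x" and "q C (q D x) = q C x"
proof -
  have C: "C \<in> countable_subsets Y"
    using assms countable_subsets_subset by blast
  have "q C x \<in> q D ` topspace X"
    using image_mono[OF assms(1,2)] assms(3) by blast
  then show "q D (q C x) = q C x"
    using image_iff[OF assms(2)] by blast
  then show "q C (q D x) = q C x"
    using commute[OF C assms(2,3)] by simp
qed

lemma closedin_image:
  assumes "C \<in> countable_subsets Y" "closedin X K"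
  shows "closedin X (q C ` K)"
  using continuous_imp_closed_map[OF continuous[OF assms(1)] compact Hausdorff] assms(2)
  by (simp add: closed_map_def)

text \<open>
  For countable \<open>S\<close> this is the image of \<open>q S\<close>; for arbitrary \<open>S\<close> it is going to be the image of the
  limit of the retractions \<open>q C\<close> with \<open>C \<subseteq> S\<close>.
\<close>

definition carrier :: "'a set \<Rightarrow> 'a set"
  where "carrier S = X closure_of (\<Union>C\<in>countable_subsets S. q C ` topspace X)"

lemma closedin_carrier: "closedin X (carrier S)"
  by (simp add: carrier_def)

lemma carrier_subset_topspace: "carrier S \<subseteq> topspace X"
  by (simp add: carrier_def closure_of_subset_topspace)

lemma carrier_mono: "S \<subseteq> S' \<Longrightarrow> carrier S \<subseteq> carrier S'"
  unfolding carrier_def by (intro closure_of_mono UN_mono) (auto intro: countable_subsets_mono)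

lemma image_subset_carrier:
  assumes "S \<subseteq> Y" "C \<in> countable_subsets S"
  shows "q C ` topspace X \<subseteq> carrier S"
proof -
  have "q C ` topspace X \<subseteq> topspace X" if "C \<in> countable_subsets S" for C
    using in_topspace[OF countable_subsets_mono[OF that assms(1)]] by blast
  then have "(\<Union>C\<in>countable_subsets S. q C ` topspace X) \<subseteq> carrier S"
    unfolding carrier_def by (intro closure_of_subset UN_least)
  then show ?thesis
    using assms(2) by blast
qed

lemma carrier_countable:
  assumes C: "C \<in> countable_subsets Y"
  shows "carrier C = q C ` topspace X"
proof
  have "q D ` topspace X \<subseteq> q C ` topspace X" if "D \<in> countable_subsets C" for D
    using image_mono[OF _ C] that by (simp add: countable_subsets_def)
  then show "carrier C \<subseteq> q C ` topspace X"
    unfolding carrier_def by (intro closure_of_minimal UN_least closedin_image[OF C]) auto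
  show "q C ` topspace X \<subseteq> carrier C"
    using C by (intro image_subset_carrier) (auto simp: countable_subsets_def)
qed

text \<open>
  If the net \<open>q C x\<close> avoided a neighbourhood of \<open>x\<close> cofinally, one could choose an increasing sequence
  of countable sets \<open>C n\<close> with \<open>q (C n) x\<close> far from \<open>x\<close>, and between them points \<open>a n\<close> close to \<open>x\<close>
  in the image of \<open>q (C (n + 1))\<close>, so close that \<open>q (C m) (a n)\<close> is far from \<open>x\<close> for all
  \<open>m \<le> n\<close>. A cluster point \<open>p\<close> of the \<open>a n\<close> is fixed by the retraction of the union, but all \<open>q (C m) p\<close>
  stay away from \<open>p\<close>, contradicting continuity along increasing sequences.
\<close>

lemma retractions_converge:
  assumes S: "S \<subseteq> Y" and x: "x \<in> carrier S" and W: "openin X W" "x \<in> W"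
  shows "\<exists>D\<in>countable_subsets S. \<forall>C\<in>countable_subsets S. D \<subseteq> C \<longrightarrow> q C x \<in> W"
proof (rule ccontr)
  assume "\<not> ?thesis"
  then have bad: "\<exists>C\<in>countable_subsets S. D \<subseteq> C \<and> q C x \<notin> W" if "D \<in> countable_subsets S" for D
    using that by blast
  note cY = countable_subsets_mono[OF _ S]
  have xX: "x \<in> topspace X"
    using x carrier_subset_topspace by blast
  obtain V where V: "openin X V" "x \<in> V" "X closure_of V \<subseteq> W"
    using compact_Hausdorff_shrink_neighbourhood[OF compact Hausdorff W] by blast
  obtain V' where V': "openin X V'" "x \<in> V'" "X closure_of V' \<subseteq> V"
    using compact_Hausdorff_shrink_neighbourhood[OF compact Hausdorff V(1,2)] by blast
  define far where "far C = {g \<in> topspace X. q C g \<in> topspace X - X closure_of V}" for C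
  have far: "openin X (far C)" if "C \<in> countable_subsets S" for C
    unfolding far_def using continuous[OF cY[OF that]] by (rule openin_continuous_map_preimage) auto
  \<comment> \<open>A stage \<open>(C, G)\<close> is a countable set with a neighbourhood of \<open>x\<close> that \<open>q C\<close> maps away from \<open>V\<close>.\<close>
  define P where "P s \<longleftrightarrow> fst s \<in> countable_subsets S \<and> openin X (snd s) \<and> x \<in> snd s \<and>
    snd s \<subseteq> far (fst s)" for s :: "'a set \<times> 'a set"
  define Q where "Q s s' \<longleftrightarrow> fst s \<subseteq> fst s' \<and> snd s' \<subseteq> snd s \<and>
    (\<exists>a. a \<in> snd s \<inter> V' \<inter> q (fst s') ` topspace X)" for s s' :: "'a set \<times> 'a set"
  have next_far: "x \<in> far C" if "C \<in> countable_subsets S" "q C x \<notin> W" for C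
    using that V(3) xX in_topspace[OF cY] by (auto simp: far_def)
  have step: "\<exists>s'. P s' \<and> Q s s'" if "P s" for s
  proof -
    obtain C G where s: "s = (C, G)"
      by (cases s)
    have C: "C \<in> countable_subsets S" and G: "openin X G" "x \<in> G" "G \<subseteq> far C"
      using that by (auto simp: P_def s)
    have "openin X (G \<inter> V')" "x \<in> G \<inter> V'"
      using G V' by auto
    then obtain a D where D: "D \<in> countable_subsets S" and a: "a \<in> q D ` topspace X" "a \<in> G \<inter> V'"
      using x unfolding carrier_def in_closure_of by blast
    obtain C' where C': "C' \<in> countable_subsets S" "C \<union> D \<subseteq> C'" "q C' x \<notin> W"
      using bad[OF countable_subsets_Un[OF C D]] by blast
    have "a \<in> q C' ` topspace X"
      using a image_mono[of D C'] C' cY by blast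
    then have "Q s (C', G \<inter> far C')"
      unfolding Q_def s using C'(2) a by auto
    moreover have "P (C', G \<inter> far C')"
      unfolding P_def using C' G far[OF C'(1)] next_far[OF C'(1,3)] by auto
    ultimately show ?thesis by blast
  qed
  obtain C0 where C0: "C0 \<in> countable_subsets S" "q C0 x \<notin> W"
    using bad[OF empty_in_countable_subsets] by blast
  have "P (C0, far C0)"
    unfolding P_def using C0(1) far[OF C0(1)] next_far[OF C0] by simp
  then obtain s where s: "\<And>n. P (s n)" "\<And>n. Q (s n) (s (Suc n))"
    using dependent_nat_choice[of "\<lambda>_. P" "\<lambda>_. Q"] step by metis
  define C where "C n = fst (s n)" for n
  define G where "G n = snd (s n)" for n
  have C: "C n \<in> countable_subsets S" and G: "G n \<subseteq> far (C n)" for n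
    using s(1)[of n] by (auto simp: P_def C_def G_def)
  have incC: "incseq C"
    using s(2) by (intro incseq_SucI) (auto simp: Q_def C_def)
  have decG: "decseq G"
    using s(2) by (intro decseq_SucI) (auto simp: Q_def G_def)
  obtain a where a: "\<And>n. a n \<in> G n \<inter> V' \<inter> q (C (Suc n)) ` topspace X"
    using s(2) unfolding Q_def C_def G_def by metis
  have aX: "a n \<in> topspace X" for n
    using a[of n] V'(1) openin_subset by blast
  define K where "K n = X closure_of (a ` {n..})" for n
  have "(\<Inter>n\<in>UNIV. K n) \<noteq> {}"
  proof (rule compact_directed_Inter_nonempty[OF compact])
    show "closedin X (K n)" for n
      by (simp add: K_def)
    show "K n \<noteq> {}" for n
      using aX by (auto simp: K_def closure_of_eq_empty_gen disjnt_def)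
    show "\<exists>k\<in>UNIV. K k \<subseteq> K i \<inter> K j" for i j
    proof (rule bexI[of _ "max i j"])
      show "K (max i j) \<subseteq> K i \<inter> K j"
        unfolding K_def by (intro Int_greatest closure_of_mono image_mono) auto
    qed simp
  qed auto
  then obtain p where p: "\<And>n. p \<in> K n"
    by blast
  have in_closed: "p \<in> L" if "closedin X L" "\<And>m. m \<ge> n \<Longrightarrow> a m \<in> L" for L n
  proof -
    have "K n \<subseteq> L"
      unfolding K_def using that by (intro closure_of_minimal) auto
    then show ?thesis
      using p by blast
  qed
  let ?D = "\<Union>n. C n"
  have D: "?D \<in> countable_subsets Y"
    using C cY by (intro countable_subsets_UN) blast
  have "V' \<subseteq> X closure_of V'"
    by (rule closure_of_subset[OF openin_subset[OF V'(1)]])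
  then have "p \<in> X closure_of V'"
    using a by (intro in_closed) auto
  then have pV: "p \<in> V"
    using V'(3) by blast
  have "q (C (Suc n)) ` topspace X \<subseteq> q ?D ` topspace X" for n
    by (rule image_mono[OF _ D]) auto
  then have "a m \<in> q ?D ` topspace X" for m
    using a[of m] by blast
  then have "p \<in> q ?D ` topspace X"
    by (intro in_closed[of _ 0] closedin_image[OF D]) auto
  then have pX: "p \<in> topspace X" and pD: "q ?D p = p"
    using image_iff[OF D] by auto
  \<comment> \<open>All later points \<open>a m\<close> are in the neighbourhood chosen at stage \<open>n\<close>, so this passes to \<open>p\<close>.\<close>
  have away: "q (C n) p \<notin> V" for n
  proof -
    let ?L = "{g \<in> topspace X. q (C n) g \<in> topspace X - V}"
    have "closedin X ?L"
      using continuous[OF cY[OF C]] by (rule closedin_continuous_map_preimage) (use V in auto)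
    moreover have "a m \<in> ?L" if "m \<ge> n" for m
    proof -
      have "a m \<in> far (C n)"
        using a[of m] G[of n] decseqD[OF decG that] by blast
      moreover have "V \<subseteq> X closure_of V"
        by (rule closure_of_subset[OF openin_subset[OF V(1)]])
      ultimately show ?thesis
        by (auto simp: far_def)
    qed
    ultimately have "p \<in> ?L"
      by (rule in_closed)
    then show ?thesis by simp
  qed
  have "limitin X (\<lambda>n. q (C n) p) p sequentially"
    using sequence_limit[of C p] C cY incC pX pD by simp
  then have "\<forall>\<^sub>F n in sequentially. q (C n) p \<in> V"
    using V(1) pV unfolding limitin_def by blast
  then show False
    using away by simp
qed

lemma carrier_separated:
  assumes S: "S \<subseteq> Y" and x: "x \<in> carrier S" and z: "z \<in> carrier S"
    and eq: "\<And>C. C \<in> countable_subsets S \<Longrightarrow> q C x = q C z"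
  shows "x = z"
proof (rule ccontr)
  assume "x \<noteq> z"
  moreover have "x \<in> topspace X" "z \<in> topspace X"
    using x z carrier_subset_topspace by auto
  ultimately obtain U V where UV: "openin X U" "openin X V" "x \<in> U" "z \<in> V" "disjnt U V"
    using Hausdorff unfolding Hausdorff_space_def by metis
  obtain D where D: "D \<in> countable_subsets S" "\<And>C. C \<in> countable_subsets S \<Longrightarrow> D \<subseteq> C \<Longrightarrow> q C x \<in> U"
    using retractions_converge[OF S x UV(1,3)] by blast
  obtain E where E: "E \<in> countable_subsets S" "\<And>C. C \<in> countable_subsets S \<Longrightarrow> E \<subseteq> C \<Longrightarrow> q C z \<in> V"
    using retractions_converge[OF S z UV(2,4)] by blast
  have DE: "D \<union> E \<in> countable_subsets S"
    by (rule countable_subsets_Un[OF D(1) E(1)])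
  then show False
    using D(2)[OF DE] E(2)[OF DE] eq[OF DE] UV(5) by (auto simp: disjnt_iff)
qed

text \<open>
  The sets of solutions \<open>z\<close> of \<open>q C z = q C x\<close> decrease as \<open>C\<close> increases, so compactness applies. With
  \<open>K = carrier S\<close> this yields the values of the limit retraction; with smaller closed sets it yields
  continuity.
\<close>

lemma common_point:
  assumes S: "S \<subseteq> Y" and K: "closedin X K" and x: "x \<in> topspace X"
    and ex: "\<And>C. C \<in> countable_subsets S \<Longrightarrow> q C x \<in> q C ` K"
  shows "\<exists>z\<in>K. \<forall>C\<in>countable_subsets S. q C z = q C x"
proof -
  note cY = countable_subsets_mono[OF _ S]
  have KX: "K \<subseteq> topspace X"
    by (rule closedin_subset[OF K])
  define L where "L C = K \<inter> {z \<in> topspace X. q C z \<in> {q C x}}" for C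
  have "(\<Inter>C\<in>countable_subsets S. L C) \<noteq> {}"
  proof (rule compact_directed_Inter_nonempty[OF compact])
    show "countable_subsets S \<noteq> {}"
      using empty_in_countable_subsets by blast
  next
    fix C assume C: "C \<in> countable_subsets S"
    show "closedin X (L C)"
      unfolding L_def
    proof (intro closedin_Int[OF K] closedin_continuous_map_preimage[OF continuous[OF cY[OF C]]])
      show "closedin X {q C x}"
        using Hausdorff in_topspace[OF cY[OF C] x] by (rule closedin_Hausdorff_singleton)
    qed
    show "L C \<noteq> {}"
      using ex[OF C] KX unfolding L_def by fastforce
  next
    fix C D assume CD: "C \<in> countable_subsets S" "D \<in> countable_subsets S"
    have U: "C \<union> D \<in> countable_subsets S"
      by (rule countable_subsets_Un[OF CD])
    have "q E z = q E x"
      if E: "E \<subseteq> C \<union> D" and z: "z \<in> topspace X" "q (C \<union> D) z = q (C \<union> D) x" for E z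
      using absorb(2)[OF E cY[OF U] z(1)] absorb(2)[OF E cY[OF U] x] z(2) by simp
    then have "L (C \<union> D) \<subseteq> L C \<inter> L D"
      unfolding L_def by auto
    then show "\<exists>E\<in>countable_subsets S. L E \<subseteq> L C \<inter> L D"
      using U by blast
  qed
  then obtain z where z: "z \<in> L C" if "C \<in> countable_subsets S" for C
    by auto
  show ?thesis
  proof (intro bexI ballI)
    show "z \<in> K"
      using z[OF empty_in_countable_subsets] by (simp add: L_def)
    show "q C z = q C x" if "C \<in> countable_subsets S" for C
      using z[OF that] by (simp add: L_def)
  qed
qed

text \<open>
  The limit of \<open>q C x\<close> over the countable \<open>C \<subseteq> S\<close>, described through its images under the \<open>q C\<close>.
\<close>

definition retract :: "'a set \<Rightarrow> 'a \<Rightarrow> 'a"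
  where "retract S x = (THE z. z \<in> carrier S \<and> (\<forall>C\<in>countable_subsets S. q C z = q C x))"

lemma retract:
  assumes S: "S \<subseteq> Y" and x: "x \<in> topspace X"
  shows retract_in_carrier: "retract S x \<in> carrier S"
    and retract_eq: "C \<in> countable_subsets S \<Longrightarrow> q C (retract S x) = q C x"
proof -
  have "q C x \<in> q C ` carrier S" if C: "C \<in> countable_subsets S" for C
  proof (rule image_eqI)
    show "q C x = q C (q C x)"
      using absorb(1)[OF order_refl countable_subsets_mono[OF C S] x] by simp
    show "q C x \<in> carrier S"
      using image_subset_carrier[OF S C] x by blast
  qed
  from common_point[OF S closedin_carrier x this]
  have "\<exists>!z. z \<in> carrier S \<and> (\<forall>C\<in>countable_subsets S. q C z = q C x)"
    using carrier_separated[OF S] by metis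
  from theI'[OF this]
  have *: "retract S x \<in> carrier S \<and> (\<forall>C\<in>countable_subsets S. q C (retract S x) = q C x)"
    unfolding retract_def .
  show "retract S x \<in> carrier S"
    using * by blast
  show "C \<in> countable_subsets S \<Longrightarrow> q C (retract S x) = q C x"
    using * by blast
qed

lemma retract_in_topspace: "S \<subseteq> Y \<Longrightarrow> x \<in> topspace X \<Longrightarrow> retract S x \<in> topspace X"
  using retract_in_carrier carrier_subset_topspace by blast

lemma retract_unique:
  assumes "S \<subseteq> Y" "x \<in> topspace X" "z \<in> carrier S"
    and "\<And>C. C \<in> countable_subsets S \<Longrightarrow> q C z = q C x"
  shows "retract S x = z"
proof (rule carrier_separated[OF assms(1) retract_in_carrier[OF assms(1,2)] assms(3)])
  show "q C (retract S x) = q C z" if "C \<in> countable_subsets S" for C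
    using retract_eq[OF assms(1,2) that] assms(4)[OF that] by simp
qed

lemma retract_fixes: "S \<subseteq> Y \<Longrightarrow> x \<in> carrier S \<Longrightarrow> retract S x = x"
  by (rule retract_unique[OF _ subsetD[OF carrier_subset_topspace]]) simp_all

lemma retract_countable:
  assumes C: "C \<in> countable_subsets Y" and x: "x \<in> topspace X"
  shows "retract C x = q C x"
proof (rule retract_unique)
  show "C \<subseteq> Y"
    using C by (simp add: countable_subsets_def)
  show "q C x \<in> carrier C"
    using x by (simp add: carrier_countable[OF C])
  show "q D (q C x) = q D x" if "D \<in> countable_subsets C" for D
    using that absorb(2)[OF _ C x] by (simp add: countable_subsets_def)
qed (rule x)

lemma retract_retract_smaller:
  assumes "S \<subseteq> S'" "S' \<subseteq> Y" "x \<in> topspace X"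
  shows "retract S (retract S' x) = retract S x"
proof (rule retract_unique)
  show "S \<subseteq> Y" "retract S' x \<in> topspace X" "retract S x \<in> carrier S"
    using assms by (auto intro!: retract_in_topspace retract_in_carrier)
  show "q C (retract S x) = q C (retract S' x)" if C: "C \<in> countable_subsets S" for C
    using retract_eq[of S x C] retract_eq[of S' x C] countable_subsets_mono[OF C assms(1)] C assms
    by simp
qed

text \<open>
  By \<open>common_point\<close> the preimage of a closed set \<open>K\<close> is the set of all \<open>x\<close> with
  \<open>q C x \<in> q C ` (K \<inter> carrier S)\<close> for every countable \<open>C \<subseteq> S\<close>, an intersection of closed sets.
\<close>

lemma continuous_retract:
  assumes S: "S \<subseteq> Y"
  shows "continuous_map X X (retract S)"
  unfolding continuous_map_closedin
proof (intro conjI allI impI)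
  show "retract S \<in> topspace X \<rightarrow> topspace X"
    using retract_in_topspace[OF S] by blast
  note cY = countable_subsets_mono[OF _ S]
  fix K assume K: "closedin X K"
  let ?K = "K \<inter> carrier S"
  have K': "closedin X ?K"
    by (intro closedin_Int K closedin_carrier)
  have "retract S x \<in> K \<longleftrightarrow> (\<forall>C\<in>countable_subsets S. q C x \<in> q C ` ?K)"
    if x: "x \<in> topspace X" for x
  proof
    assume "retract S x \<in> K"
    then have "retract S x \<in> ?K"
      using retract_in_carrier[OF S x] by blast
    then show "\<forall>C\<in>countable_subsets S. q C x \<in> q C ` ?K"
      using retract_eq[OF S x] by (metis image_eqI)
  next
    assume "\<forall>C\<in>countable_subsets S. q C x \<in> q C ` ?K"
    then obtain z where "z \<in> ?K" "\<forall>C\<in>countable_subsets S. q C z = q C x"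
      using common_point[OF S K' x] by blast
    then show "retract S x \<in> K"
      using retract_unique[OF S x, of z] by simp
  qed
  then have "{x \<in> topspace X. retract S x \<in> K} =
      {x \<in> topspace X. \<forall>C\<in>countable_subsets S. q C x \<in> q C ` ?K}"
    by (rule Collect_cong[OF conj_cong[OF refl]])
  also have "\<dots> = topspace X \<inter> (\<Inter>C\<in>countable_subsets S. {x \<in> topspace X. q C x \<in> q C ` ?K})"
    by auto
  finally have eq: "{x \<in> topspace X. retract S x \<in> K} = \<dots>" .
  have "closedin X {x \<in> topspace X. q C x \<in> q C ` ?K}" if "C \<in> countable_subsets S" for C
    using continuous[OF cY[OF that]] closedin_image[OF cY[OF that] K']
    by (rule closedin_continuous_map_preimage)
  moreover have "countable_subsets S \<noteq> {}"
    using empty_in_countable_subsets by blast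
  ultimately show "closedin X {x \<in> topspace X. retract S x \<in> K}"
    unfolding eq by (intro closedin_Int closedin_topspace closedin_INT) auto
qed

text \<open>
  For countable \<open>D \<subseteq> S\<close> the point \<open>q C (q D x) = q D (q C x)\<close> is in the carrier of \<open>S\<close>; as \<open>q D x\<close> tends to
  \<open>retract S x\<close>, the limit \<open>q C (retract S x)\<close> of such points belongs to the carrier as well.
\<close>

lemma retract_commute:
  assumes S: "S \<subseteq> Y" and C: "C \<in> countable_subsets Y" and x: "x \<in> topspace X"
  shows "retract S (q C x) = q C (retract S x)"
proof (rule retract_unique[OF S in_topspace[OF C x]])
  note cY = countable_subsets_mono[OF _ S]
  have rX: "retract S x \<in> topspace X"
    by (rule retract_in_topspace[OF S x])
  show "q D (q C (retract S x)) = q D (q C x)" if D: "D \<in> countable_subsets S" for D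
    using commute[OF C cY[OF D] x] commute[OF C cY[OF D] rX] retract_eq[OF S x D] by simp
  let ?L = "{z \<in> topspace X. q C z \<in> carrier S}"
  have L: "closedin X ?L"
    using continuous[OF C] closedin_carrier by (rule closedin_continuous_map_preimage)
  have "q D x \<in> ?L" if D: "D \<in> countable_subsets S" for D
    using commute[OF C cY[OF D] x] image_subset_carrier[OF S D] in_topspace[OF C x]
      in_topspace[OF cY[OF D] x] by auto
  moreover have "\<exists>D\<in>countable_subsets S. q D x \<in> topspace X - ?L" if "retract S x \<notin> ?L"
  proof -
    have "openin X (topspace X - ?L)" "retract S x \<in> topspace X - ?L"
      using L that rX by auto
    then obtain D where D: "D \<in> countable_subsets S" "q D (retract S x) \<in> topspace X - ?L"
      using retractions_converge[OF S retract_in_carrier[OF S x]] by blast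
    then show ?thesis
      using retract_eq[OF S x D(1)] by (intro bexI[of _ D]) auto
  qed
  ultimately have "retract S x \<in> ?L"
    by blast
  then show "q C (retract S x) \<in> carrier S"
    by blast
qed

lemma singleton_in: "y \<in> Y \<Longrightarrow> {y} \<in> countable_subsets Y"
  by (simp add: countable_subsets_def)

lemma singleton_fixes: "y \<in> Y \<Longrightarrow> q {y} y = y"
  using subset_image[OF singleton_in[of y]] image_iff[OF singleton_in[of y], of y] by simp

text \<open>
  Commutativity is essential here: it makes every \<open>retract S\<close> map \<open>Y\<close> into \<open>Y\<close>, and moreover keeps
  all values \<open>retract S y\<close> for a fixed \<open>y\<close> in one image with a countable network.
\<close>

lemma retract_in_image:
  assumes "S \<subseteq> Y" "y \<in> Y"
  shows "retract S y \<in> q {y} ` topspace X"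
proof -
  have y: "y \<in> topspace X"
    using assms subset_topspace by blast
  have "retract S y = q {y} (retract S y)"
    using retract_commute[OF assms(1) singleton_in[OF assms(2)] y] singleton_fixes[OF assms(2)]
    by simp
  then show ?thesis
    using retract_in_topspace[OF assms(1) y] by (rule image_eqI)
qed

lemma retract_in_Y: "S \<subseteq> Y \<Longrightarrow> y \<in> Y \<Longrightarrow> retract S y \<in> Y"
  using retract_in_image[of S y] in_Y[OF singleton_in[of y]] by auto

text \<open>
  A countable set is an increasing union of finite sets, so continuity along sequences reduces the
  retractions \<open>q C\<close> to those with finite index. This takes the place of continuity at limit stages in
  transfinite constructions.
\<close>

lemma retract_determined_by_finite:
  assumes S: "S \<subseteq> Y" and x: "x \<in> topspace X" and z: "z \<in> topspace X"
    and eq: "\<And>F. finite F \<Longrightarrow> F \<subseteq> S \<Longrightarrow> q F x = q F z"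
  shows "retract S x = retract S z"
proof (rule carrier_separated[OF S])
  show "retract S x \<in> carrier S" "retract S z \<in> carrier S"
    using S x z by (auto intro: retract_in_carrier)
  fix C assume C: "C \<in> countable_subsets S"
  have "q C x = q C z"
  proof (cases "C = {}")
    case False
    define f where "f = from_nat_into C"
    have f: "C = range f"
      using range_from_nat_into[OF False] C by (simp add: f_def countable_subsets_def)
    have B: "f ` {..n} \<in> countable_subsets Y" "f ` {..n} \<subseteq> S" for n
      using C S f by (auto simp: countable_subsets_def)
    have inc: "incseq (\<lambda>n. f ` {..n})"
      by (auto simp: incseq_def)
    have U: "(\<Union>n. f ` {..n}) = C"
      unfolding f by auto
    have lx: "limitin X (\<lambda>n. q (f ` {..n}) x) (q C x) sequentially"
      using sequence_limit[OF B(1) inc x] unfolding U .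
    have lz: "limitin X (\<lambda>n. q (f ` {..n}) x) (q C z) sequentially"
      using sequence_limit[OF B(1) inc z] unfolding U using eq[OF _ B(2)] by simp
    show ?thesis
      by (rule limitin_Hausdorff_unique[OF lx lz trivial_limit_sequentially Hausdorff])
  qed (simp add: eq)
  then show "q C (retract S x) = q C (retract S z)"
    using retract_eq[OF S x C] retract_eq[OF S z C] by simp
qed

end

section \<open>Separating families with countable supports\<close>

lemma finite_has_greatest:
  assumes r: "Linear_order r" and "finite F" "F \<noteq> {}" "F \<subseteq> Field r"
  shows "\<exists>b\<in>F. \<forall>c\<in>F. (c, b) \<in> r"
  using assms(2-4)
proof (induction F rule: finite_ne_induct)
  case (singleton a)
  then show ?case
    using r by (auto simp: order_on_defs refl_on_def)
next
  case (insert a F)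
  then obtain b where b: "b \<in> F" "\<forall>c\<in>F. (c, b) \<in> r"
    by auto
  have refl: "(a, a) \<in> r" and trans: "trans r"
    using r insert.prems by (auto simp: order_on_defs refl_on_def)
  have "(a, b) \<in> r \<or> (b, a) \<in> r"
    using r insert.prems b(1) refl by (cases "a = b") (auto simp: order_on_defs total_on_def)
  then show ?case
    using b refl transD[OF trans] by blast
qed

lemma embedding_map_separating:
  fixes f :: "'i \<Rightarrow> 'a \<Rightarrow> real"
  assumes X: "compact_space X"
    and f: "\<And>t. t \<in> T \<Longrightarrow> continuous_map X euclideanreal (f t)"
    and sep: "\<And>x z. x \<in> topspace X \<Longrightarrow> z \<in> topspace X \<Longrightarrow> (\<And>t. t \<in> T \<Longrightarrow> f t x = f t z) \<Longrightarrow> x = z"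
  shows "embedding_map X (powertop_real T) (\<lambda>x. \<lambda>t\<in>T. f t x)"
proof (rule injective_closed_imp_embedding_map)
  show cont: "continuous_map X (powertop_real T) (\<lambda>x. \<lambda>t\<in>T. f t x)"
    unfolding continuous_map_componentwise using f by (simp add: image_subset_iff)
  show "closed_map X (powertop_real T) (\<lambda>x. \<lambda>t\<in>T. f t x)"
    using cont X by (rule continuous_imp_closed_map) (simp add: Hausdorff_space_product_topology)
  show "inj_on (\<lambda>x. \<lambda>t\<in>T. f t x) (topspace X)"
  proof (rule inj_onI)
    fix x z assume xz: "x \<in> topspace X" "z \<in> topspace X"
      and eq: "(\<lambda>t\<in>T. f t x) = (\<lambda>t\<in>T. f t z)"
    show "x = z"
    proof (rule sep[OF xz])
      show "f t x = f t z" if "t \<in> T" for t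
        using fun_cong[OF eq, of t] that by simp
    qed
  qed
qed

context commutative_skeleton
begin

text \<open>
  The value \<open>retract (under r a) y\<close> at a jump \<open>a\<close> is outside the carrier of \<open>underS r a\<close>, which contains all
  earlier values. So each jump has its own member of a countable network of \<open>q {y}\<close>: one that
  contains the new value and whose image misses that carrier.
\<close>

lemma countable_jumps:
  fixes r :: "'a rel"
  assumes r: "Well_order r" and field: "Field r \<subseteq> Y" and y: "y \<in> Y"
  shows "countable {a \<in> Field r. retract (under r a) y \<noteq> retract (underS r a) y}"
    (is "countable ?J")
proof -
  have total: "Total r" and antisym: "antisym r" and trans: "trans r"
    using r by (auto simp: order_on_defs well_order_on_def)
  have sub: "under r a \<subseteq> Y" "underS r a \<subseteq> Y" "underS r a \<subseteq> under r a" for a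
    using field under_Field[of r a] underS_subset_under[of r a] by auto
  have yX: "y \<in> topspace X"
    using y subset_topspace by blast
  obtain \<N> where \<N>: "countable \<N>" "network_of Y (subtopology X Y) (q {y}) \<N>"
    using network[OF singleton_in[OF y]] by blast
  define p where "p a = retract (under r a) y" for a
  have p: "p a \<in> Y" "q {y} (p a) = p a" for a
    using retract_in_Y[OF sub(1) y] retract_in_image[OF sub(1) y] image_iff[OF singleton_in[OF y]]
    by (auto simp: p_def)
  have fresh: "p a \<notin> carrier (underS r a)" if "a \<in> ?J" for a
  proof
    assume "p a \<in> carrier (underS r a)"
    then have "p a = retract (underS r a) (p a)"
      using retract_fixes[OF sub(2)] by simp
    then show False
      using that retract_retract_smaller[OF sub(3,1) yX] by (simp add: p_def)
  qed
  have "\<exists>N. N \<in> \<N> \<and> p a \<in> N \<and> q {y} ` N \<inter> carrier (underS r a) = {}" if a: "a \<in> ?J" for a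
  proof -
    have "openin (subtopology X Y) (Y - carrier (underS r a))"
      using closedin_carrier[of "underS r a"] subset_topspace
      by (auto simp: openin_subtopology closedin_def)
    then obtain N where "N \<in> \<N>" "p a \<in> N" "q {y} ` N \<subseteq> Y - carrier (underS r a)"
      using \<N>(2) p[of a] fresh[OF a] unfolding network_of_def by (metis DiffI)
    then show ?thesis by blast
  qed
  then have "\<forall>a\<in>?J. \<exists>N. N \<in> \<N> \<and> p a \<in> N \<and> q {y} ` N \<inter> carrier (underS r a) = {}"
    by blast
  from bchoice[OF this] obtain N where N: "\<And>a. a \<in> ?J \<Longrightarrow> N a \<in> \<N>"
    "\<And>a. a \<in> ?J \<Longrightarrow> p a \<in> N a"
    "\<And>a. a \<in> ?J \<Longrightarrow> q {y} ` N a \<inter> carrier (underS r a) = {}"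
    by fast
  have later: "N b \<noteq> N a" if ab: "a \<in> ?J" "b \<in> ?J" "(b, a) \<in> r" "b \<noteq> a" for a b
  proof
    assume "N b = N a"
    then have "q {y} (p b) \<in> q {y} ` N a"
      using N(2)[OF ab(2)] by simp
    moreover have "p b \<in> carrier (under r b)"
      unfolding p_def using sub(1) yX by (rule retract_in_carrier)
    moreover have "under r b \<subseteq> underS r a"
      using ab(3,4) trans antisym unfolding under_def underS_def
      by (auto dest: transD antisymD)
    ultimately show False
      using carrier_mono[of "under r b" "underS r a"] N(3)[OF ab(1)] p(2)[of b] by auto
  qed
  have "inj_on N ?J"
  proof (rule inj_onI, rule ccontr)
    fix a b assume ab: "a \<in> ?J" "b \<in> ?J" "N a = N b" "a \<noteq> b"
    then have "(a, b) \<in> r \<or> (b, a) \<in> r"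
      using total by (auto simp: total_on_def)
    then show False
      using later[OF ab(1,2)] later[OF ab(2,1)] ab(3,4) by auto
  qed
  moreover have "countable (N ` ?J)"
    using N(1) by (intro countable_subset[OF _ \<N>(1)]) blast
  ultimately show ?thesis
    by (rule countable_image_inj_on[rotated])
qed

text \<open>
  The inductive invariant. For \<open>S = Y\<close> such a family embeds \<open>X\<close>, as \<open>retract Y\<close> is the identity if
  \<open>Y\<close> is dense. The bound on supports concerns all of \<open>Y\<close>, not only the part of it in the carrier of
  \<open>S\<close>, so that families for different \<open>S\<close> can be united.
\<close>

definition separating_family :: "'a set \<Rightarrow> ('a \<Rightarrow> real) set \<Rightarrow> bool"
  where "separating_family S H \<longleftrightarrow>
    (\<forall>h\<in>H. continuous_map X euclideanreal h) \<and>
    (\<forall>x\<in>topspace X. \<forall>z\<in>topspace X. (\<forall>h\<in>H. h x = h z) \<longrightarrow> retract S x = retract S z) \<and>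
    (\<forall>y\<in>Y. countable {h \<in> H. h y \<noteq> 0})"

lemma separating_familyD:
  assumes "separating_family S H"
  shows "h \<in> H \<Longrightarrow> continuous_map X euclideanreal h"
    and "x \<in> topspace X \<Longrightarrow> z \<in> topspace X \<Longrightarrow> (\<And>h. h \<in> H \<Longrightarrow> h x = h z) \<Longrightarrow>
      retract S x = retract S z"
    and "y \<in> Y \<Longrightarrow> countable {h \<in> H. h y \<noteq> 0}"
proof -
  show "h \<in> H \<Longrightarrow> continuous_map X euclideanreal h"
    and "y \<in> Y \<Longrightarrow> countable {h \<in> H. h y \<noteq> 0}"
    using assms by (simp_all add: separating_family_def)
  assume "x \<in> topspace X" "z \<in> topspace X" and eq: "\<And>h. h \<in> H \<Longrightarrow> h x = h z"
  moreover have "\<forall>h\<in>H. h x = h z"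
    by (rule ballI) (rule eq)
  ultimately show "retract S x = retract S z"
    using assms unfolding separating_family_def by blast
qed

lemma separating_familyI:
  assumes "\<And>h. h \<in> H \<Longrightarrow> continuous_map X euclideanreal h"
    and "\<And>x z. x \<in> topspace X \<Longrightarrow> z \<in> topspace X \<Longrightarrow> (\<And>h. h \<in> H \<Longrightarrow> h x = h z) \<Longrightarrow>
      retract S x = retract S z"
    and "\<And>y. y \<in> Y \<Longrightarrow> countable {h \<in> H. h y \<noteq> 0}"
  shows "separating_family S H"
  unfolding separating_family_def
proof (intro conjI ballI impI)
  show "retract S x = retract S z"
    if "x \<in> topspace X" "z \<in> topspace X" "\<forall>h\<in>H. h x = h z" for x z
    by (rule assms(2)[OF that(1,2) bspec[OF that(3)]])
qed (fact assms(1,3))+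

text \<open>
  The image of \<open>q C\<close> has a countable network. Urysohn functions for the pairs of members with disjoint
  closures separate its points.
\<close>

lemma separating_family_countable:
  assumes C: "C \<in> countable_subsets Y"
  shows "\<exists>H. separating_family C H"
proof -
  obtain \<N> where \<N>: "countable \<N>" "network_of Y (subtopology X Y) (q C) \<N>"
    using network[OF C] by blast
  have normal: "normal_space X"
    using compact Hausdorff compact_Hausdorff_or_regular_imp_normal_space by blast
  define cl where "cl N = X closure_of (q C ` N)" for N
  define J where "J = {(M, N). M \<in> \<N> \<and> N \<in> \<N> \<and> disjnt (cl M) (cl N)}"
  have "\<exists>f. continuous_map X euclideanreal f \<and> f ` cl M \<subseteq> {0} \<and> f ` cl N \<subseteq> {1}"
    if "(M, N) \<in> J" for M N
  proof -
    have "closedin X (cl M)" "closedin X (cl N)" "disjnt (cl M) (cl N)"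
      using that by (auto simp: cl_def J_def)
    from Urysohn_lemma_alt[OF normal this, of 0 1] show ?thesis
      by metis
  qed
  then obtain f where f: "\<And>M N. (M, N) \<in> J \<Longrightarrow> continuous_map X euclideanreal (f M N)"
    "\<And>M N. (M, N) \<in> J \<Longrightarrow> f M N ` cl M \<subseteq> {0}" "\<And>M N. (M, N) \<in> J \<Longrightarrow> f M N ` cl N \<subseteq> {1}"
    by metis
  define H where "H = (\<lambda>(M, N). f M N \<circ> q C) ` J"
  have "countable J"
    by (rule countable_subset[of _ "\<N> \<times> \<N>"]) (use \<N>(1) in \<open>auto simp: J_def\<close>)
  then have H: "countable H"
    by (simp add: H_def)
  have near: "\<exists>N\<in>\<N>. z \<in> N \<and> cl N \<subseteq> U" if z: "z \<in> Y" "q C z = z" "openin X U" "z \<in> U" for z U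
  proof -
    obtain V where V: "openin X V" "z \<in> V" "X closure_of V \<subseteq> U"
      using compact_Hausdorff_shrink_neighbourhood[OF compact Hausdorff z(3,4)] by blast
    have "openin (subtopology X Y) (Y \<inter> V)"
      using V(1) by (auto simp: openin_subtopology)
    moreover have "q C z \<in> Y \<inter> V"
      using z V by simp
    ultimately obtain N where N: "N \<in> \<N>" "z \<in> N" "q C ` N \<subseteq> Y \<inter> V"
      using \<N>(2) z(1) unfolding network_of_def by metis
    then have "cl N \<subseteq> X closure_of V"
      unfolding cl_def by (intro closure_of_mono) blast
    then show ?thesis
      using N V(3) by blast
  qed
  have separates: "retract C x = retract C z"
    if x: "x \<in> topspace X" and z: "z \<in> topspace X" and eq: "\<And>h. h \<in> H \<Longrightarrow> h x = h z" for x z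
  proof (rule ccontr)
    assume "retract C x \<noteq> retract C z"
    then have "q C x \<noteq> q C z"
      by (simp add: retract_countable[OF C] x z)
    then obtain U V where UV: "openin X U" "openin X V" "q C x \<in> U" "q C z \<in> V" "disjnt U V"
      using Hausdorff in_topspace[OF C x] in_topspace[OF C z] unfolding Hausdorff_space_def by metis
    obtain M where M: "M \<in> \<N>" "q C x \<in> M" "cl M \<subseteq> U"
      using near[OF in_Y[OF C x] absorb(1)[OF order_refl C x] UV(1,3)] by blast
    obtain N where N: "N \<in> \<N>" "q C z \<in> N" "cl N \<subseteq> V"
      using near[OF in_Y[OF C z] absorb(1)[OF order_refl C z] UV(2,4)] by blast
    have MN: "(M, N) \<in> J"
      using M N UV(5) by (auto simp: J_def disjnt_iff)
    have incl: "w \<in> cl K" if "K \<in> \<N>" "w \<in> K" "q C w = w" for w K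
    proof -
      have "K \<subseteq> Y"
        using \<N>(2) that(1) by (auto simp: network_of_def)
      then have "q C ` K \<subseteq> topspace X"
        using in_topspace[OF C] subset_topspace by blast
      then have "q C ` K \<subseteq> cl K"
        unfolding cl_def by (rule closure_of_subset)
      then show ?thesis
        using that(2,3) by (metis image_eqI subsetD)
    qed
    have "f M N (q C x) = 0" "f M N (q C z) = 1"
      using f(2,3)[OF MN] incl[OF M(1,2) absorb(1)[OF order_refl C x]]
        incl[OF N(1,2) absorb(1)[OF order_refl C z]] by auto
    moreover have "f M N \<circ> q C \<in> H"
      using MN by (force simp: H_def)
    ultimately show False
      using eq[of "f M N \<circ> q C"] by simp
  qed
  have cont: "continuous_map X euclideanreal h" if "h \<in> H" for h
    using that f(1) continuous[OF C] by (auto simp: H_def intro: continuous_map_compose)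
  have supp: "countable {h \<in> H. h y \<noteq> 0}" for y
    using H by (rule countable_subset[rotated]) blast
  have "separating_family C H"
    by (rule separating_familyI[OF cont separates supp])
  then show ?thesis ..
qed

text \<open>
  At stage \<open>a\<close> only pairs of points with the same image under \<open>retract (underS r a)\<close> remain to be
  separated, and for them the increment \<open>d a h\<close> does the same as \<open>h\<close>. It vanishes at \<open>y\<close> unless \<open>a\<close>
  is a jump of \<open>y\<close>. For fixed \<open>a\<close> it depends on the values of \<open>h\<close> at two points of \<open>Y\<close>, so it is
  nonzero at \<open>y\<close> for countably many \<open>h\<close> at most.
\<close>

lemma separating_family_step:
  fixes r :: "'a rel"
  assumes r: "Well_order r" and field: "Field r \<subseteq> Y"
    and initial: "\<And>a. a \<in> Field r \<Longrightarrow> \<exists>H. separating_family (under r a) H"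
  shows "\<exists>H. separating_family (Field r) H"
proof -
  have sub: "under r a \<subseteq> Y" "underS r a \<subseteq> Y" "underS r a \<subseteq> under r a" for a
    using field under_Field[of r a] underS_subset_under[of r a] by auto
  obtain G where G: "\<And>a. a \<in> Field r \<Longrightarrow> separating_family (under r a) (G a)"
    using initial by metis
  obtain G0 where G0: "separating_family {} G0"
    using separating_family_countable[of "{}"] by auto
  define d where "d a h x = h (retract (under r a) x) - h (retract (underS r a) x)"
    for a and h :: "'a \<Rightarrow> real" and x
  define H where "H = G0 \<union> (\<Union>a\<in>Field r. d a ` G a)"
  have cont: "continuous_map X euclideanreal g" if "g \<in> H" for g
  proof (cases "g \<in> G0")
    case True
    then show ?thesis
      by (rule separating_familyD(1)[OF G0])
  next
    case False
    then obtain a h where a: "a \<in> Field r" "h \<in> G a" and g: "g = d a h"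
      using \<open>g \<in> H\<close> by (auto simp: H_def)
    have h: "continuous_map X euclideanreal h"
      using separating_familyD(1)[OF G] a by blast
    have "continuous_map X euclideanreal (\<lambda>x. h (retract (under r a) x))"
      "continuous_map X euclideanreal (\<lambda>x. h (retract (underS r a) x))"
      using continuous_map_compose[OF continuous_retract[OF sub(1)] h]
        continuous_map_compose[OF continuous_retract[OF sub(2)] h] by (simp_all add: comp_def)
    then show ?thesis
      unfolding g d_def[abs_def] by (rule continuous_map_diff)
  qed
  have separates: "retract (Field r) x = retract (Field r) z"
    if x: "x \<in> topspace X" and z: "z \<in> topspace X" and eq: "\<And>g. g \<in> H \<Longrightarrow> g x = g z" for x z
  proof -
    have wf: "wf (r - Id)" and linear: "Linear_order r"
      using r by (auto simp: well_order_on_def)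
    \<comment> \<open>The empty set has no greatest element; the functions in \<open>G0\<close> take care of it.\<close>
    have finite_case: "q F x = q F z"
      if F: "finite F" "F \<subseteq> Field r"
        and eq_F: "\<And>b. b \<in> F \<Longrightarrow> retract (under r b) x = retract (under r b) z" for F
    proof -
      have "retract F x = retract F z"
      proof (cases "F = {}")
        case True
        then show ?thesis
          using eq separating_familyD(2)[OF G0 x z] by (simp add: H_def)
      next
        case False
        then obtain b where b: "b \<in> F" "\<And>c. c \<in> F \<Longrightarrow> (c, b) \<in> r"
          using finite_has_greatest[OF linear F(1) _ F(2)] by blast
        then have "F \<subseteq> under r b"
          by (auto simp: under_def)
        then show ?thesis
          using retract_retract_smaller[OF _ sub(1) x] retract_retract_smaller[OF _ sub(1) z]
            eq_F[OF b(1)] by metis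
      qed
      moreover have "F \<in> countable_subsets Y"
        using F field by (auto simp: countable_subsets_def intro: countable_finite)
      ultimately show ?thesis
        using x z by (simp add: retract_countable)
    qed
    have under_eq: "retract (under r a) x = retract (under r a) z" if "a \<in> Field r" for a
      using that
    proof (induction a rule: wf_induct_rule[OF wf])
      case (1 a)
      have below: "retract (underS r a) x = retract (underS r a) z"
      proof (rule retract_determined_by_finite[OF sub(2) x z])
        fix F assume F: "finite F" "F \<subseteq> underS r a"
        show "q F x = q F z"
        proof (rule finite_case[OF F(1)])
          show "F \<subseteq> Field r"
            using F(2) underS_subset_under[of r a] under_Field[of r a] by blast
          show "retract (under r b) x = retract (under r b) z" if "b \<in> F" for b
            using that F(2) "1.IH"[of b] by (auto simp: underS_def Field_def)
        qed
      qed
      have "retract (under r a) (retract (under r a) x) = retract (under r a) (retract (under r a) z)"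
      proof (rule separating_familyD(2)[OF G[OF "1.prems"]])
        fix h assume "h \<in> G a"
        then have "d a h x = d a h z"
          using "1.prems" by (intro eq) (auto simp: H_def)
        then show "h (retract (under r a) x) = h (retract (under r a) z)"
          using below by (simp add: d_def)
      qed (use x z sub retract_in_topspace in auto)
      then show ?case
        using retract_retract_smaller[OF order_refl sub(1)] x z by simp
    qed
    show ?thesis
    proof (rule retract_determined_by_finite[OF field x z])
      show "q F x = q F z" if "finite F" "F \<subseteq> Field r" for F
        using that under_eq by (intro finite_case) auto
    qed
  qed
  have supp: "countable {g \<in> H. g y \<noteq> 0}" if y: "y \<in> Y" for y
  proof -
    let ?J = "{a \<in> Field r. retract (under r a) y \<noteq> retract (underS r a) y}"
    let ?K = "\<lambda>a. {h \<in> G a. h (retract (under r a) y) \<noteq> 0} \<union> {h \<in> G a. h (retract (underS r a) y) \<noteq> 0}"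
    have "{g \<in> H. g y \<noteq> 0} \<subseteq> {g \<in> G0. g y \<noteq> 0} \<union> (\<Union>a\<in>?J. d a ` ?K a)"
      by (auto simp: H_def d_def)
    moreover have K: "countable (?K a)" if "a \<in> ?J" for a
      using separating_familyD(3)[OF G] retract_in_Y[OF sub(1) y] retract_in_Y[OF sub(2) y] that
      by (intro countable_Un) auto
    have "countable ({g \<in> G0. g y \<noteq> 0} \<union> (\<Union>a\<in>?J. d a ` ?K a))"
      using separating_familyD(3)[OF G0 y] countable_UN[OF countable_jumps[OF r field y] countable_image[OF K]]
      by (rule countable_Un)
    ultimately show ?thesis
      by (rule countable_subset)
  qed
  have "separating_family (Field r) H"
    by (rule separating_familyI[OF cont separates supp])
  then show ?thesis ..
qed

text \<open>
  In the well-order given by the cardinal of an uncountable set all initial segments are of smaller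
  cardinality, so the induction proceeds on the cardinality of \<open>S\<close>.
\<close>

lemma ex_separating_family:
  includes cardinal_syntax
  assumes "S \<subseteq> Y"
  shows "\<exists>H. separating_family S H"
proof -
  have wf: "wf (inv_image ordLess (card_of :: 'a set \<Rightarrow> 'a rel))"
    by (rule wf_inv_image[OF wf_ordLess])
  show ?thesis
    using assms
  proof (induction S rule: wf_induct_rule[OF wf])
    case (1 S)
    show ?case
    proof (cases "countable S")
      case True
      then show ?thesis
        using "1.prems" by (intro separating_family_countable) (simp add: countable_subsets_def)
    next
      case False
      then have "infinite S"
        using countable_finite by blast
      have smaller: "|under |S| a| <o |S|" if "a \<in> S" for a
      proof -
        have "|underS |S| a| <o |S|"
          using that by (intro card_of_underS card_of_Card_order) (simp add: Field_card_of)
        moreover have "|{a}| <o |S|"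
          using \<open>infinite S\<close> by (intro finite_ordLess_infinite card_of_Well_order) (auto simp: Field_card_of)
        ultimately have "|underS |S| a \<union> {a}| <o |S|"
          by (rule card_of_Un_ordLess_infinite[OF \<open>infinite S\<close>])
        moreover have "under |S| a \<subseteq> underS |S| a \<union> {a}"
          by (auto simp: under_def underS_def)
        ultimately show ?thesis
          using card_of_mono1 ordLeq_ordLess_trans by blast
      qed
      have "\<exists>H. separating_family (Field |S| ) H"
      proof (rule separating_family_step)
        show "Well_order |S|"
          by (rule card_of_Well_order)
        show "Field |S| \<subseteq> Y"
          using "1.prems" by (simp add: Field_card_of)
        fix a assume a: "a \<in> Field |S|"
        have "under |S| a \<subseteq> S"
          using under_Field[of "|S|" a] by (simp add: Field_card_of)
        then show "\<exists>H. separating_family (under |S| a) H"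
          using smaller a "1.prems" by (intro "1.IH") (auto simp: in_inv_image Field_card_of)
      qed
      then show ?thesis
        by (simp add: Field_card_of)
    qed
  qed
qed

lemma Valdivia_if_dense:
  assumes "dense_in_space X Y"
  shows "Valdivia X"
proof -
  have dense: "X closure_of Y = topspace X"
    using assms by (simp add: dense_in_space_def)
  obtain H where H: "separating_family Y H"
    using ex_separating_family by blast
  have "y \<in> carrier Y" if "y \<in> Y" for y
    using image_subset_carrier[of Y "{y}"] subset_image[OF singleton_in[OF that]] that
      singleton_in[OF that] by auto
  then have "topspace X \<subseteq> carrier Y"
    unfolding dense[symmetric] by (intro closure_of_minimal closedin_carrier) blast
  then have fixed: "retract Y x = x" if "x \<in> topspace X" for x
    using that by (intro retract_fixes) auto
  define \<phi> where "\<phi> x = (\<lambda>h\<in>H. h x)" for x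
  have "embedding_map X (powertop_real H) (\<lambda>x. \<lambda>h\<in>H. h x)"
  proof (rule embedding_map_separating[OF compact])
    show "x = z" if "x \<in> topspace X" "z \<in> topspace X" "\<And>h. h \<in> H \<Longrightarrow> h x = h z" for x z
      using separating_familyD(2)[OF H that] fixed that(1,2) by simp
  qed (rule separating_familyD(1)[OF H])
  then have emb: "embedding_map X (powertop_real H) \<phi>"
    by (simp add: \<phi>_def[abs_def])
  let ?Y = "{x \<in> topspace X. \<phi> x \<in> Sigma_product H}"
  have "{h \<in> H. \<phi> y h \<noteq> 0} = {h \<in> H. h y \<noteq> 0}" for y
    by (auto simp: \<phi>_def)
  then have "Y \<subseteq> ?Y"
    using subset_topspace separating_familyD(3)[OF H] by (auto simp: Sigma_product_def \<phi>_def)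
  then have "topspace X \<subseteq> X closure_of ?Y"
    unfolding dense[symmetric] by (rule closure_of_mono)
  then have "dense_in_space X ?Y"
    using closure_of_subset_topspace[of X ?Y] by (auto simp: dense_in_space_def)
  then show ?thesis
    using compact Hausdorff Sigma_subsetI[OF emb] unfolding Valdivia_def by blast
qed

end

section \<open>From monotone retractions to a skeleton\<close>

locale commuting_monotone_retractions =
  fixes X :: "'a topology" and Y :: "'a set" and r :: "'a set \<Rightarrow> 'a \<Rightarrow> 'a"
    and \<O> :: "'a set \<Rightarrow> 'a set set"
  assumes compact: "compact_space X" and Hausdorff: "Hausdorff_space X"
    and subset_topspace: "Y \<subseteq> topspace X"
    and monotone: "monotone_retractions X Y r \<O>"
    and commute:
      "A \<in> countable_subsets Y \<Longrightarrow> B \<in> countable_subsets Y \<Longrightarrow> x \<in> topspace X \<Longrightarrow>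
        r A (r B x) = r B (r A x)"
begin

lemma retraction: "A \<in> countable_subsets Y \<Longrightarrow> retraction_to X Y (r A)"
  and subset_image: "A \<in> countable_subsets Y \<Longrightarrow> A \<subseteq> r A ` topspace X"
  and network: "A \<in> countable_subsets Y \<Longrightarrow> network_of Y (subtopology X Y) (r A) (\<O> A)"
  and omega_monotone: "omega_monotone Y (Pow Y) \<O>"
  using monotone by (auto simp: monotone_retractions_def)

lemma in_Y: "A \<in> countable_subsets Y \<Longrightarrow> x \<in> topspace X \<Longrightarrow> r A x \<in> Y"
  using retraction by (auto simp: retraction_to_def)

lemma idem: "A \<in> countable_subsets Y \<Longrightarrow> x \<in> topspace X \<Longrightarrow> r A (r A x) = r A x"
  using retraction by (auto simp: retraction_to_def)

lemma fixes_points: "A \<in> countable_subsets Y \<Longrightarrow> a \<in> A \<Longrightarrow> r A a = a"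
  using subset_image[of A] idem[of A] by auto

lemma closedin_image:
  assumes A: "A \<in> countable_subsets Y"
  shows "closedin X (r A ` topspace X)"
proof -
  have "continuous_map X X (r A)"
    using retraction[OF A] by (simp add: retraction_to_def)
  then show ?thesis
    using continuous_imp_closed_map[OF _ compact Hausdorff, of "r A"] by (simp add: closed_map_def)
qed

text \<open>
  Pairs are considered in order to compare the retractions for two index sets: a point of both sets
  that lies in a network member of each is fixed by both retractions.
\<close>

definition saturated :: "'a set \<Rightarrow> bool"
  where "saturated A \<longleftrightarrow> A \<in> countable_subsets Y \<and>
    (\<forall>M\<in>\<O> A. \<forall>N\<in>\<O> A. M \<inter> N \<noteq> {} \<longrightarrow> A \<inter> (M \<inter> N) \<noteq> {})"

lemma network_open:
  assumes A: "A \<in> countable_subsets Y" and y: "y \<in> Y" and U: "openin X U" "r A y \<in> U"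
  obtains N where "N \<in> \<O> A" "y \<in> N" "r A ` N \<subseteq> U"
proof -
  have "openin (subtopology X Y) (Y \<inter> U)"
    using U(1) by (auto simp: openin_subtopology)
  moreover have "r A y \<in> Y \<inter> U"
    using U(2) in_Y[OF A] y subset_topspace by blast
  ultimately obtain N where "N \<in> \<O> A" "y \<in> N" "r A ` N \<subseteq> Y \<inter> U"
    using network[OF A] y unfolding network_of_def by metis
  then show thesis
    by (intro that) auto
qed

text \<open>
  A network member that contains a fixed point \<open>y\<close> of \<open>r A\<close>, and is mapped close to \<open>y\<close>, contains a point
  of \<open>A\<close>; being fixed, that point is close to \<open>y\<close> itself.
\<close>

lemma saturated_image:
  assumes "saturated A"
  shows "r A ` topspace X = X closure_of A"
proof
  have A: "A \<in> countable_subsets Y"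
    using assms by (simp add: saturated_def)
  show "X closure_of A \<subseteq> r A ` topspace X"
    using subset_image[OF A] closedin_image[OF A] by (rule closure_of_minimal)
  show "r A ` topspace X \<subseteq> X closure_of A"
  proof
    fix y assume "y \<in> r A ` topspace X"
    then have y: "y \<in> Y" "r A y = y"
      using in_Y[OF A] idem[OF A] by auto
    show "y \<in> X closure_of A"
      unfolding in_closure_of
    proof (intro conjI allI impI)
      show "y \<in> topspace X"
        using y subset_topspace by blast
      fix U assume U: "y \<in> U \<and> openin X U"
      then obtain N where N: "N \<in> \<O> A" "y \<in> N" "r A ` N \<subseteq> U"
        using network_open[OF A y(1), of U] y(2) by auto
      then obtain a where a: "a \<in> A" "a \<in> N"
        using assms by (fastforce simp: saturated_def)
      then have "a \<in> U"
        using fixes_points[OF A a(1)] N(3) by (metis image_subset_iff)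
      then show "\<exists>a. a \<in> A \<and> a \<in> U"
        using a(1) by blast
    qed
  qed
qed

text \<open>
  Let \<open>p\<close> be the supposed limit, a point of \<open>Y\<close>. Some \<open>N \<in> \<O> (A m)\<close> contains \<open>p\<close> and is
  mapped close to \<open>p\<close> by the retraction of the union. If \<open>r (A n) p\<close> were far from \<open>p\<close> with \<open>n \<ge> m\<close>, some
  \<open>M \<in> \<O> (A n)\<close> would contain \<open>p\<close> and be mapped far away by \<open>r (A n)\<close>. By saturation \<open>M \<inter> N\<close> contains a point of
  \<open>A n\<close>; both retractions fix it, so it is close to \<open>p\<close> and far from it.
\<close>

lemma saturated_sequence_limit:
  assumes sat: "\<And>n. saturated (A n)" and inc: "incseq A" and x: "x \<in> topspace X"
  shows "limitin X (\<lambda>n. r (A n) x) (r (\<Union>n. A n) x) sequentially"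
proof -
  let ?A = "\<Union>n. A n"
  have An: "A n \<in> countable_subsets Y" for n
    using sat by (simp add: saturated_def)
  then have A: "?A \<in> countable_subsets Y"
    by (rule countable_subsets_UN)
  define p where "p = r ?A x"
  have p: "p \<in> Y" "p \<in> topspace X" "r ?A p = p"
    using in_Y[OF A x] idem[OF A x] subset_topspace by (auto simp: p_def)
  have same: "r (A n) x = r (A n) p" for n
  proof -
    have "r (A n) ` topspace X \<subseteq> X closure_of ?A"
      unfolding saturated_image[OF sat] by (intro closure_of_mono) auto
    also have "\<dots> \<subseteq> r ?A ` topspace X"
      using subset_image[OF A] closedin_image[OF A] by (rule closure_of_minimal)
    finally have "r (A n) x \<in> r ?A ` topspace X"
      using x by blast
    then have "r ?A (r (A n) x) = r (A n) x"
      using idem[OF A] by auto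
    then show ?thesis
      using commute[OF An A x] by (simp add: p_def)
  qed
  have "\<forall>\<^sub>F n in sequentially. r (A n) p \<in> W" if W: "openin X W" "p \<in> W" for W
  proof -
    obtain U where U: "openin X U" "p \<in> U" "X closure_of U \<subseteq> W"
      using compact_Hausdorff_shrink_neighbourhood[OF compact Hausdorff W] by blast
    obtain N where N: "N \<in> \<O> ?A" "p \<in> N" "r ?A ` N \<subseteq> U"
      using network_open[OF A p(1) U(1)] p(3) U(2) by auto
    then obtain m where m: "N \<in> \<O> (A m)"
      using omega_monotone_UN[OF omega_monotone An inc] by blast
    have "r (A n) p \<in> W" if n: "m \<le> n" for n
    proof (rule ccontr)
      assume "r (A n) p \<notin> W"
      then have far: "r (A n) p \<in> topspace X - X closure_of U"
        using U(3) in_Y[OF An p(2)] subset_topspace by blast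
      have "openin X (topspace X - X closure_of U)"
        by (intro openin_diff openin_topspace closedin_closure_of)
      then obtain M where M: "M \<in> \<O> (A n)" "p \<in> M" "r (A n) ` M \<subseteq> topspace X - X closure_of U"
        using network_open[OF An p(1) _ far] by blast
      have "N \<in> \<O> (A n)"
        using m omega_monotone_incseq[OF omega_monotone An inc] n by (auto simp: incseq_def)
      then obtain a where a: "a \<in> A n" "a \<in> N" "a \<in> M"
        using sat[of n] M(1,2) N(2) unfolding saturated_def by blast
      have "r ?A a = a" "r (A n) a = a"
        using a(1) by (auto intro: fixes_points[OF A] fixes_points[OF An])
      then have "a \<in> U" "a \<notin> X closure_of U"
        using N(3) M(3) a(2,3) by (auto simp: image_subset_iff)
      then show False
        using closure_of_subset[OF openin_subset[OF U(1)]] by blast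
    qed
    then show ?thesis
      unfolding eventually_sequentially by blast
  qed
  then show ?thesis
    using p(2) by (simp add: limitin_def same flip: p_def)
qed

lemma ex_commutative_skeleton:
  obtains q where "commutative_skeleton X Y q"
proof -
  define c where "c N = (SOME a. a \<in> N)" for N :: "'a set"
  \<comment> \<open>The empty value keeps the operation inside \<open>Y\<close> when the intersection has no point to choose.\<close>
  define g where "g = (\<lambda>(M, N). if M \<inter> N = {} then {} else {c (M \<inter> N)})"
  have c: "c N \<in> N" if "N \<noteq> {}" for N
    unfolding c_def using that by (simp add: some_in_eq)
  have "g P \<in> countable_subsets Y" if "P \<in> Pow Y \<times> Pow Y" for P
    using that c[of "fst P \<inter> snd P"] by (auto simp: g_def countable_subsets_def split: if_splits)
  from omega_monotone_closing_off[OF omega_monotone_compose[OF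
      omega_monotone_square[OF omega_monotone] omega_monotone_Union[OF this]]]
  obtain \<Phi> where \<Phi>_cl: "omega_monotone Y Y \<Phi> \<and>
    (\<forall>A\<in>countable_subsets Y. A \<subseteq> \<Phi> A \<and> (\<Union>P\<in>\<O> (\<Phi> A) \<times> \<O> (\<Phi> A). g P) \<subseteq> \<Phi> A)" ..
  note \<Phi> = conjunct1[OF \<Phi>_cl]
  have ext: "A \<subseteq> \<Phi> A" and closed: "(\<Union>P\<in>\<O> (\<Phi> A) \<times> \<O> (\<Phi> A). g P) \<subseteq> \<Phi> A"
    if "A \<in> countable_subsets Y" for A
    using bspec[OF conjunct2[OF \<Phi>_cl] that] by simp_all
  note \<Phi>_in = omega_monotone_in[OF \<Phi>]
  have sat: "saturated (\<Phi> A)" if A: "A \<in> countable_subsets Y" for A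
    unfolding saturated_def
  proof (intro conjI ballI impI)
    show "\<Phi> A \<in> countable_subsets Y"
      by (rule \<Phi>_in[OF A])
    fix M N assume MN: "M \<in> \<O> (\<Phi> A)" "N \<in> \<O> (\<Phi> A)" "M \<inter> N \<noteq> {}"
    then have "c (M \<inter> N) \<in> g (M, N)"
      by (simp add: g_def)
    then have "c (M \<inter> N) \<in> \<Phi> A"
      using closed[OF A] MN(1,2) by blast
    then show "\<Phi> A \<inter> (M \<inter> N) \<noteq> {}"
      using c[OF MN(3)] by blast
  qed
  have "commutative_skeleton X Y (\<lambda>C. r (\<Phi> C))"
  proof
    fix C assume C: "C \<in> countable_subsets Y"
    show "retraction_to X Y (r (\<Phi> C))"
      by (rule retraction[OF \<Phi>_in[OF C]])
    show "C \<subseteq> r (\<Phi> C) ` topspace X"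
      using ext[OF C] subset_image[OF \<Phi>_in[OF C]] by blast
    show "\<exists>\<N>. countable \<N> \<and> network_of Y (subtopology X Y) (r (\<Phi> C)) \<N>"
      using network[OF \<Phi>_in[OF C]] omega_monotone_in[OF omega_monotone \<Phi>_in[OF C]]
      by (auto simp: countable_subsets_def)
    show "r (\<Phi> C) (r (\<Phi> D) x) = r (\<Phi> D) (r (\<Phi> C) x)"
      if "D \<in> countable_subsets Y" "x \<in> topspace X" for D x
      by (rule commute[OF \<Phi>_in[OF C] \<Phi>_in[OF that(1)] that(2)])
  next
    fix C D assume CD: "C \<subseteq> D" and D: "D \<in> countable_subsets Y"
    have C: "C \<in> countable_subsets Y"
      using countable_subsets_subset[OF D CD] .
    show "r (\<Phi> C) ` topspace X \<subseteq> r (\<Phi> D) ` topspace X"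
      unfolding saturated_image[OF sat[OF C]] saturated_image[OF sat[OF D]]
      by (intro closure_of_mono omega_monotone_subset[OF \<Phi> CD D])
  next
    fix B :: "nat \<Rightarrow> 'a set" and x
    assume B: "\<And>n. B n \<in> countable_subsets Y" "incseq B" and x: "x \<in> topspace X"
    show "limitin X (\<lambda>n. r (\<Phi> (B n)) x) (r (\<Phi> (\<Union>n. B n)) x) sequentially"
      unfolding omega_monotone_UN[OF \<Phi> B]
      by (rule saturated_sequence_limit[OF sat[OF B(1)] omega_monotone_incseq[OF \<Phi> B] x])
  qed (fact compact Hausdorff subset_topspace)+
  then show thesis
    by (rule that)
qed

end

section \<open>The characterization\<close>

lemma Sigma_subset_retractable:
  assumes X: "compact_space X" and dense: "dense_in_space X Y" and Sigma: "Sigma_subset X Y"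
  shows "commutatively_monotonically_retractable X Y"
proof -
  obtain T :: "('a \<Rightarrow> real) set" and \<phi> where emb: "embedding_map X (powertop_real T) \<phi>"
    and Y: "Y = {x \<in> topspace X. \<phi> x \<in> Sigma_product T}"
    using Sigma unfolding Sigma_subset_def by blast
  have cont: "continuous_map X (powertop_real T) \<phi>"
    using emb unfolding embedding_map_def
    using continuous_map_in_subtopology homeomorphic_imp_continuous_map by blast
  have \<phi>: "\<phi> x \<in> extensional T" if "x \<in> topspace X" for x
    using cont that by (auto simp: continuous_map_componentwise)
  have coord: "continuous_map X euclideanreal (\<lambda>x. \<phi> x t)" if "t \<in> T" for t
    using cont that by (auto simp: continuous_map_componentwise)
  have inj: "inj_on \<phi> (topspace X)"
    using emb unfolding embedding_map_def homeomorphic_eq_everything_map by blast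
  interpret dense_Sigma_coordinates X T "\<lambda>t x. \<phi> x t" Y
  proof
    show "x = z" if "x \<in> topspace X" "z \<in> topspace X" "\<And>t. t \<in> T \<Longrightarrow> \<phi> x t = \<phi> z t" for x z
    proof (rule inj_onD[OF inj _ that(1,2)])
      show "\<phi> x = \<phi> z"
        using \<phi> that by (intro extensionalityI[of _ T])
    qed
    show "x \<in> Y \<longleftrightarrow> x \<in> topspace X \<and> countable {t \<in> T. \<phi> x t \<noteq> 0}" for x
      using \<phi>[of x] by (auto simp: Y Sigma_product_def PiE_iff)
    show "X closure_of Y = topspace X"
      using dense by (simp add: dense_in_space_def)
  qed (fact X coord)+
  show ?thesis
    by (rule commutatively_monotonically_retractable)
qed

theorem corollary4p4:
  fixes X :: "'a topology"
  assumes "compact_space X" and "Hausdorff_space X"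
  shows "Valdivia X \<longleftrightarrow>
    (\<exists>Y. dense_in_space X Y \<and> commutatively_monotonically_retractable X Y)"
proof
  assume "Valdivia X"
  then show "\<exists>Y. dense_in_space X Y \<and> commutatively_monotonically_retractable X Y"
    using Sigma_subset_retractable[OF assms(1)] unfolding Valdivia_def by blast
next
  assume "\<exists>Y. dense_in_space X Y \<and> commutatively_monotonically_retractable X Y"
  then obtain Y r \<O> where dense: "dense_in_space X Y" and "Y \<subseteq> topspace X"
    "monotone_retractions X Y r \<O>"
    "\<And>A B x. A \<in> countable_subsets Y \<Longrightarrow> B \<in> countable_subsets Y \<Longrightarrow> x \<in> topspace X \<Longrightarrow>
      r A (r B x) = r B (r A x)"
    unfolding commutatively_monotonically_retractable_def by blast
  then interpret commuting_monotone_retractions X Y r \<O>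
    using assms by unfold_locales
  obtain q where "commutative_skeleton X Y q"
    by (rule ex_commutative_skeleton)
  then show "Valdivia X"
    using dense by (rule commutative_skeleton.Valdivia_if_dense)
qed

end
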